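(* Let $G$ be a finite group which is not nilpotent, and let $\alpha:G\times S\to S$ be a faithful left action of $G$ on a set $S$. Then for every integer $n\geq 2$ and every $\ell>0$ there exists an everywhere-nonempty 2-sorted algebra $\mathbf{B}(n,\ell)=(B_1,B_2;s)$ in the signature $\tau$ such that: (1) $\mathbf{B}(n,\ell)$ is $(n+1,1)$-generated; (2) $B_1$ and $B_2$ are finite and nonempty; (3) $|B_2|\geq \ell$; (4) every everywhere-nonempty $(n,n)$-generated subalgebra of $\mathbf{B}(n,\ell)$ belongs to $\mathscr{V}(\mathbb{A}(G,S,\alpha))$.
   Context: The signature $\tau$ consists of a single binary operation symbol $s$ of type $1\times 2\to 2$; a 2-sorted algebra in $\tau$ is $(A_1,A_2;s)$ with $s:A_1\times A_2\to A_2$, and it is everywhere nonempty if $A_1,A_2\neq\varnothing$. Subalgebras, products, homomorphic images are defined sortwise as usual. For a class $K$ of everywhere-nonempty such algebras, $\mathscr{V}(K)$ is the closure of $K$ under products, everywhere-nonempty subalgebras and homomorphic images. $\mathbb{A}(G,S,\alpha)$ denotes the 2-sorted algebra $(G,S;\alpha)$. A pair $(U_1,U_2)$ with $\varnothing\neq U_i\subseteq A_i$ generates $\mathbf{A}=(A_1,A_2;s)$ if the only subalgebra $(C_1,C_2;s)$ of $\mathbf{A}$ with $U_i\subseteq C_i$ ($i=1,2$) is $\mathbf{A}$ itself; for $n_1,n_2\geq 1$, $\mathbf{A}$ is $(n_1,n_2)$-generated if it is generated by some $(U_1,U_2)$ with $0<|U_i|\leq n_i$ for $i=1,2$. *)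

theory Defs
  imports
    "HOL-Algebra.Group_Action"
    "HOL-Algebra.Generated_Groups"
    "HOL-Library.FuncSet"
    "HOL-Library.Infinite_Typeclass"
begin

section \<open>Nilpotent groups\<close>

fun lower_central :: "('a, 'm) monoid_scheme \<Rightarrow> nat \<Rightarrow> 'a set" where
  "lower_central G 0 = carrier G"
| "lower_central G (Suc k) =
     generate G {x \<otimes>\<^bsub>G\<^esub> y \<otimes>\<^bsub>G\<^esub> inv\<^bsub>G\<^esub> x \<otimes>\<^bsub>G\<^esub> inv\<^bsub>G\<^esub> y | x y.
                   x \<in> lower_central G k \<and> y \<in> carrier G}"

definition nilpotent_group :: "('a, 'm) monoid_scheme \<Rightarrow> bool" where
  "nilpotent_group G \<longleftrightarrow> group G \<and> (\<exists>k. lower_central G k = {\<one>\<^bsub>G\<^esub>})"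


section \<open>Two-sorted algebras\<close>

text \<open>The values of \<^term>\<open>act\<close> outside the two carriers are irrelevant: no notion below depends on
  them.\<close>

record ('a, 'b) alg2 =
  sort1 :: "'a set"
  sort2 :: "'b set"
  act :: "'a \<Rightarrow> 'b \<Rightarrow> 'b"

definition algebra2 :: "('a, 'b) alg2 \<Rightarrow> bool" where
  "algebra2 A \<longleftrightarrow> (\<forall>x\<in>sort1 A. \<forall>y\<in>sort2 A. act A x y \<in> sort2 A)"

definition everywhere_nonempty :: "('a, 'b) alg2 \<Rightarrow> bool" where
  "everywhere_nonempty A \<longleftrightarrow> sort1 A \<noteq> {} \<and> sort2 A \<noteq> {}"

definition subalgebra2 :: "('a, 'b) alg2 \<Rightarrow> ('a, 'b) alg2 \<Rightarrow> bool" where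
  "subalgebra2 C A \<longleftrightarrow>
     algebra2 C \<and> sort1 C \<subseteq> sort1 A \<and> sort2 C \<subseteq> sort2 A \<and>
     (\<forall>x\<in>sort1 C. \<forall>y\<in>sort2 C. act C x y = act A x y)"

definition hom2 ::
  "('a, 'b) alg2 \<Rightarrow> ('c, 'd) alg2 \<Rightarrow> ('a \<Rightarrow> 'c) \<Rightarrow> ('b \<Rightarrow> 'd) \<Rightarrow> bool" where
  "hom2 A B f g \<longleftrightarrow>
     algebra2 A \<and> algebra2 B \<and> f \<in> sort1 A \<rightarrow> sort1 B \<and> g \<in> sort2 A \<rightarrow> sort2 B \<and>
     (\<forall>x\<in>sort1 A. \<forall>y\<in>sort2 A. g (act A x y) = act B (f x) (g y))"

definition hom_image2 :: "('a, 'b) alg2 \<Rightarrow> ('c, 'd) alg2 \<Rightarrow> bool" where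
  "hom_image2 A B \<longleftrightarrow> (\<exists>f g. hom2 A B f g \<and> f ` sort1 A = sort1 B \<and> g ` sort2 A = sort2 B)"

definition isomorphic2 :: "('a, 'b) alg2 \<Rightarrow> ('c, 'd) alg2 \<Rightarrow> bool" where
  "isomorphic2 A B \<longleftrightarrow>
     (\<exists>f g. hom2 A B f g \<and> bij_betw f (sort1 A) (sort1 B) \<and> bij_betw g (sort2 A) (sort2 B))"

definition prod2 :: "'i set \<Rightarrow> ('i \<Rightarrow> ('a, 'b) alg2) \<Rightarrow> ('i \<Rightarrow> 'a, 'i \<Rightarrow> 'b) alg2" where
  "prod2 I A =
     \<lparr>sort1 = (\<Pi>\<^sub>E i\<in>I. sort1 (A i)),
      sort2 = (\<Pi>\<^sub>E i\<in>I. sort2 (A i)),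
      act = (\<lambda>x y. \<lambda>i\<in>I. act (A i) (x i) (y i))\<rparr>"

definition generates2 :: "('a, 'b) alg2 \<Rightarrow> 'a set \<Rightarrow> 'b set \<Rightarrow> bool" where
  "generates2 A U1 U2 \<longleftrightarrow>
     U1 \<noteq> {} \<and> U2 \<noteq> {} \<and> U1 \<subseteq> sort1 A \<and> U2 \<subseteq> sort2 A \<and>
     (\<forall>C. subalgebra2 C A \<and> U1 \<subseteq> sort1 C \<and> U2 \<subseteq> sort2 C \<longrightarrow>
          sort1 C = sort1 A \<and> sort2 C = sort2 A)"

definition generated2 :: "nat \<Rightarrow> nat \<Rightarrow> ('a, 'b) alg2 \<Rightarrow> bool" where
  "generated2 n1 n2 A \<longleftrightarrow>
     (\<exists>U1 U2. finite U1 \<and> finite U2 \<and> 0 < card U1 \<and> card U1 \<le> n1 \<and> 0 < card U2 \<and> card U2 \<le> n2 \<and>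
              generates2 A U1 U2)"

definition action_algebra ::
  "('g, 'm) monoid_scheme \<Rightarrow> 's set \<Rightarrow> ('g \<Rightarrow> 's \<Rightarrow> 's) \<Rightarrow> ('g, 's) alg2" where
  "action_algebra G S \<alpha> = \<lparr>sort1 = carrier G, sort2 = S, act = \<alpha>\<rparr>"


section \<open>The variety generated by a class\<close>

text \<open>Closing a class under products in a typed setting needs a type that contains its own tuples.
  The following type contains a copy of \<^typ>\<open>'a\<close> and all of its own \<^typ>\<open>'i\<close>-indexed tuples, so
  products indexed by any set of type \<^typ>\<open>'i set\<close>, and iterations of them with subalgebras and
  homomorphic images, can be formed inside it.\<close>

datatype ('a, 'i) tower = Atom 'a | Tuple "'i \<Rightarrow> ('a, 'i) tower"

text \<open>Transport of structure along maps injective on the carriers.\<close>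

definition copy2 :: "('a \<Rightarrow> 'c) \<Rightarrow> ('b \<Rightarrow> 'd) \<Rightarrow> ('a, 'b) alg2 \<Rightarrow> ('c, 'd) alg2" where
  "copy2 f g A =
     \<lparr>sort1 = f ` sort1 A,
      sort2 = g ` sort2 A,
      act = (\<lambda>x y. g (act A (inv_into (sort1 A) f x) (inv_into (sort2 A) g y)))\<rparr>"

inductive_set variety_closure ::
  "('a, 'b) alg2 set \<Rightarrow> (('a, 'i) tower, ('b, 'i) tower) alg2 set"
  for K :: "('a, 'b) alg2 set" where
  base: "A \<in> K \<Longrightarrow> copy2 Atom Atom A \<in> variety_closure K"
| prod: "(\<And>i. i \<in> I \<Longrightarrow> A i \<in> variety_closure K) \<Longrightarrow>
           copy2 Tuple Tuple (prod2 I A) \<in> variety_closure K"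
| sub: "A \<in> variety_closure K \<Longrightarrow> subalgebra2 C A \<Longrightarrow> everywhere_nonempty C \<Longrightarrow>
          C \<in> variety_closure K"
| image: "A \<in> variety_closure K \<Longrightarrow> hom_image2 A B \<Longrightarrow> B \<in> variety_closure K"

text \<open>Membership of an algebra with carriers in arbitrary types, up to isomorphism. The argument
  \<^term>\<open>TYPE('i)\<close> bounds the index sets of products. For infinite \<^typ>\<open>'i\<close> this bound does not
  matter for countable \<^term>\<open>B\<close>: the relatively free algebra on countably many generators has
  countably many pairs of distinct elements, each of which is separated by a homomorphism into a
  member of \<^term>\<open>K\<close>, so it embeds into a countable product of members of \<^term>\<open>K\<close>, and
  \<^term>\<open>B\<close> lies in the variety iff it is an image of such an algebra.\<close>

definition in_variety ::
  "'i itself \<Rightarrow> ('a, 'b) alg2 set \<Rightarrow> ('c, 'd) alg2 \<Rightarrow> bool" where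
  "in_variety T K B \<longleftrightarrow>
     (\<exists>A \<in> (variety_closure K :: (('a, 'i) tower, ('b, 'i) tower) alg2 set). isomorphic2 A B)"

end

theory Submission
  imports
    Defs
    "HOL-Algebra.Weak_Morphisms"
    "HOL-Algebra.Sylow"
    "HOL-Algebra.Multiplicative_Group"
    "HOL-Number_Theory.Cong"
begin

text \<open>
  A finite algebra lies in the variety as soon as any two words over its first sort that agree as
  laws of \<open>G\<close> act equally on its second sort. Consider the set \<open>\<Omega> \<times> (\<int>/q)\<^sup>n\<close> with the generators
  \<open>x\<^sub>1, \<dots>, x\<^sub>n\<close> acting as the unit translations of the second factor, and a further generator \<open>v\<close>
  acting on the fibre over \<open>(0,\<dots>,0)\<close> by a permutation \<open>u\<close> of \<open>\<Omega>\<close>, on the fibre over \<open>(1,\<dots>,1)\<close> by a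
  permutation \<open>u'\<close>, and trivially elsewhere, where \<open>u\<^sup>p = u'\<^sup>p = 1\<close>. Suitable \<open>u\<close>, \<open>u'\<close> make this
  transitive with \<open>\<Omega>\<close> arbitrarily large. If some \<open>x\<^sub>j\<close> is missing, an orbit meets at most one of the
  two special fibres, so a word acts through its letter counts modulo \<open>q\<close> and, for each translate, the
  number modulo \<open>p\<close> of the occurrences of \<open>v\<close> at that translate.

  These invariants are determined by the laws of a non-nilpotent \<open>G\<close>. A minimal non-nilpotent group
  satisfying the laws of \<open>G\<close> has trivial centre and is not simple; it contains an abelian normal
  subgroup \<open>A\<close> of exponent \<open>p\<close> and an element \<open>g\<close> inducing on \<open>A\<close> an automorphism of prime order
  \<open>q \<noteq> p\<close>. Evaluate \<open>v\<close> at a commutator \<open>[b, g]\<close> with \<open>b \<in> A\<close> and \<open>x\<^sub>i\<close> at powers of \<open>g\<close>; averaging over all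
  choices of the exponents isolates the individual counts, since \<open>q\<close> is invertible modulo \<open>p\<close>.
\<close>

section \<open>Laws and membership in the variety\<close>

definition word_val :: "('g, 'm) monoid_scheme \<Rightarrow> (nat \<Rightarrow> 'g) \<Rightarrow> nat list \<Rightarrow> 'g" where
  "word_val G \<phi> w = foldr (\<lambda>i x. \<phi> i \<otimes>\<^bsub>G\<^esub> x) w \<one>\<^bsub>G\<^esub>"

text \<open>Words are positive: a term of the second sort is a word in first-sort variables applied
  to one second-sort variable, and the signature offers no inverses.\<close>

definition law :: "('g, 'm) monoid_scheme \<Rightarrow> nat list \<Rightarrow> nat list \<Rightarrow> bool" where
  "law G w w' \<longleftrightarrow> (\<forall>\<phi>. range \<phi> \<subseteq> carrier G \<longrightarrow> word_val G \<phi> w = word_val G \<phi> w')"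

lemma word_val_Nil [simp]: "word_val G \<phi> [] = \<one>\<^bsub>G\<^esub>"
  by (simp add: word_val_def)

lemma word_val_Cons [simp]: "word_val G \<phi> (i # w) = \<phi> i \<otimes>\<^bsub>G\<^esub> word_val G \<phi> w"
  by (simp add: word_val_def)

lemma word_val_cong: "(\<And>i. i \<in> set w \<Longrightarrow> \<phi> i = \<psi> i) \<Longrightarrow> word_val G \<phi> w = word_val G \<psi> w"
  by (induction w) auto

lemma (in monoid) word_val_closed [simp]:
  "(\<And>i. i \<in> set w \<Longrightarrow> \<phi> i \<in> carrier G) \<Longrightarrow> word_val G \<phi> w \<in> carrier G"
  by (induction w) auto

lemma (in group_hom) word_val_hom:
  "range \<phi> \<subseteq> carrier G \<Longrightarrow> h (word_val G \<phi> w) = word_val H (\<lambda>i. h (\<phi> i)) w"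
  by (induction w) (auto simp: image_subset_iff)

section \<open>Transport of algebras along injections\<close>

lemma act_copy2:
  assumes "inj_on f (sort1 A)" "inj_on g (sort2 A)" "x \<in> sort1 A" "y \<in> sort2 A"
  shows "act (copy2 f g A) (f x) (g y) = g (act A x y)"
  using assms by (simp add: copy2_def)

lemma sort_copy2 [simp]:
  "sort1 (copy2 f g A) = f ` sort1 A" "sort2 (copy2 f g A) = g ` sort2 A"
  by (simp_all add: copy2_def)

lemma algebra2_copy2:
  assumes "algebra2 A" "inj_on f (sort1 A)" "inj_on g (sort2 A)"
  shows "algebra2 (copy2 f g A)"
  using assms by (auto simp: algebra2_def act_copy2)

lemma isomorphic2_copy2:
  assumes "algebra2 A" "inj_on f (sort1 A)" "inj_on g (sort2 A)"
  shows "isomorphic2 (copy2 f g A) A"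
proof -
  have "hom2 (copy2 f g A) A (inv_into (sort1 A) f) (inv_into (sort2 A) g)"
    using assms algebra2_copy2[OF assms] by (auto simp: hom2_def act_copy2 algebra2_def)
  moreover have "bij_betw (inv_into (sort1 A) f) (sort1 (copy2 f g A)) (sort1 A)"
    "bij_betw (inv_into (sort2 A) g) (sort2 (copy2 f g A)) (sort2 A)"
    using assms by (auto intro!: bij_betw_inv_into simp: inj_on_imp_bij_betw)
  ultimately show ?thesis unfolding isomorphic2_def by blast
qed

text \<open>Numbers are encoded by nesting depth. This gives a copy of an algebra on natural numbers
  inside the types in which \<open>variety_closure\<close> lives.\<close>

primrec nat_tower :: "nat \<Rightarrow> ('a, 'i) tower" where
  "nat_tower 0 = Atom undefined"
| "nat_tower (Suc k) = Tuple (\<lambda>_. nat_tower k)"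

lemma inj_nat_tower: "inj nat_tower"
proof (rule injI)
  show "nat_tower x = nat_tower y \<Longrightarrow> x = y" for x y
  proof (induction x arbitrary: y)
    case 0
    then show ?case by (cases y) auto
  next
    case (Suc x)
    then show ?case by (cases y) (auto dest: fun_cong)
  qed
qed

text \<open>Serves to define a map on the image of a parametrization \<open>h\<close> by its value
  \<open>k\<close> at a chosen preimage; the hypothesis makes the choice immaterial.\<close>

lemma factor_through:
  assumes "\<And>p q. p \<in> Q \<Longrightarrow> q \<in> Q \<Longrightarrow> h p = h q \<Longrightarrow> k p = k q"
  obtains g where "\<And>p. p \<in> Q \<Longrightarrow> g (h p) = k p"
proof
  show "(k \<circ> inv_into Q h) (h p) = k p" if "p \<in> Q" for p
    using that assms[of "inv_into Q h (h p)" p] by (simp add: inv_into_into f_inv_into_f)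
qed

text \<open>By faithfulness some point tells apart each of the finitely many pairs of distinct group
  elements, and one such point per pair suffices. The two distinct points in the conclusion later
  separate second-sort variables.\<close>

lemma (in faithful_action) finite_separating_set:
  assumes "finite (carrier G)" "carrier G \<noteq> {\<one>\<^bsub>G\<^esub>}"
  obtains T where "finite T" "T \<subseteq> E"
    "\<And>g h. g \<in> carrier G \<Longrightarrow> h \<in> carrier G \<Longrightarrow> (\<And>t. t \<in> T \<Longrightarrow> \<phi> g t = \<phi> h t) \<Longrightarrow> g = h"
    "\<exists>s\<in>T. \<exists>t\<in>T. s \<noteq> t"
proof -
  have "\<exists>t\<in>E. \<phi> g t \<noteq> \<phi> h t" if "g \<in> carrier G" "h \<in> carrier G" "g \<noteq> h" for g h
  proof (rule ccontr)
    assume "\<not> ?thesis"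
    then have "\<phi> g = \<phi> h"
      using bij_prop0[OF that(1)] bij_prop0[OF that(2)]
      by (intro extensionalityI[of _ E]) (auto simp: Bij_def)
    with that faithful show False by (auto dest: inj_onD)
  qed
  then obtain t where t: "\<And>g h. g \<in> carrier G \<Longrightarrow> h \<in> carrier G \<Longrightarrow> g \<noteq> h \<Longrightarrow>
      t g h \<in> E \<and> \<phi> g (t g h) \<noteq> \<phi> h (t g h)"
    by metis
  define T0 where "T0 = {t g h | g h. g \<in> carrier G \<and> h \<in> carrier G \<and> g \<noteq> h}"
  \<comment> \<open>The images are adjoined to get two distinct points: for
    \<open>g \<noteq> \<one>\<close>, the images of \<open>t g \<one>\<close> under \<open>g\<close>
    and \<open>\<one>\<close> differ.\<close>
  define T where "T = T0 \<union> (\<Union>g\<in>carrier G. \<phi> g ` T0)"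
  have "T0 \<subseteq> (\<lambda>(g, h). t g h) ` (carrier G \<times> carrier G)"
    by (auto simp: T0_def)
  then have "finite T0" by (rule finite_subset) (use assms in auto)
  then have "finite T" using assms by (auto simp: T_def)
  have "T0 \<subseteq> E" using t by (auto simp: T0_def)
  then have "T \<subseteq> E" by (auto simp: T_def dest: element_image)
  have sep: "g = h" if "g \<in> carrier G" "h \<in> carrier G" "\<And>t. t \<in> T \<Longrightarrow> \<phi> g t = \<phi> h t" for g h
    using t[of g h] that(3)[of "t g h"] that(1,2) by (auto simp: T_def T0_def)
  interpret group_hom G "BijGroup E" \<phi> by (rule group_hom)
  obtain g where g: "g \<in> carrier G" "g \<noteq> \<one>\<^bsub>G\<^esub>"
    using assms(2) G.one_closed by blast
  have "\<phi> g (t g \<one>\<^bsub>G\<^esub>) \<in> T" "\<phi> \<one>\<^bsub>G\<^esub> (t g \<one>\<^bsub>G\<^esub>) \<in> T"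
  proof -
    have "t g \<one>\<^bsub>G\<^esub> \<in> T0" using g by (auto simp: T0_def)
    then show "\<phi> g (t g \<one>\<^bsub>G\<^esub>) \<in> T" "\<phi> \<one>\<^bsub>G\<^esub> (t g \<one>\<^bsub>G\<^esub>) \<in> T"
      unfolding T_def using g(1) G.one_closed by blast+
  qed
  with t[OF g(1) G.one_closed g(2)] have "\<exists>s\<in>T. \<exists>t\<in>T. s \<noteq> t" by blast
  with \<open>finite T\<close> \<open>T \<subseteq> E\<close> sep show ?thesis by (rule that)
qed

text \<open>The algebra is an image of the relatively free algebra on its own elements. Finitely many points
  of \<open>S\<close> separate the elements of \<open>G\<close>, so that free algebra sits inside a finite power.\<close>

lemma in_variety_if_laws:
  fixes G :: "('a, 'm) monoid_scheme" and S :: "'b set" and C :: "(nat, nat) alg2"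
  assumes act: "faithful_action G S \<alpha>"
    and fin: "finite (carrier G)" and nontriv: "carrier G \<noteq> {\<one>\<^bsub>G\<^esub>}"
    and C: "algebra2 C" "everywhere_nonempty C" "finite (sort1 C)" "finite (sort2 C)"
    and laws: "\<And>w w' y. set w \<subseteq> sort1 C \<Longrightarrow> set w' \<subseteq> sort1 C \<Longrightarrow> law G w w' \<Longrightarrow>
      y \<in> sort2 C \<Longrightarrow> foldr (act C) w y = foldr (act C) w' y"
  shows "in_variety TYPE('i::infinite) {action_algebra G S \<alpha>} C"
proof -
  interpret faithful_action G S \<alpha> by (rule act)
  interpret group_hom G "BijGroup S" \<alpha> by (rule group_hom)
  obtain T where T: "finite T" "T \<subseteq> S"
    "\<And>g h. g \<in> carrier G \<Longrightarrow> h \<in> carrier G \<Longrightarrow> (\<And>t. t \<in> T \<Longrightarrow> \<alpha> g t = \<alpha> h t) \<Longrightarrow> g = h"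
    "\<exists>s\<in>T. \<exists>t\<in>T. s \<noteq> t"
    using finite_separating_set[OF fin nontriv] by blast
  obtain t0 t1 where t01: "t0 \<in> T" "t1 \<in> T" "t0 \<noteq> t1" using T(4) by blast
  obtain g1 where g1: "g1 \<in> carrier G" "g1 \<noteq> \<one>\<^bsub>G\<^esub>" using nontriv G.one_closed by blast
  define C1 where "C1 = sort1 C"
  define C2 where "C2 = sort2 C"
  \<comment> \<open>All assignments of the variables, which are the elements of \<open>C\<close>
    themselves. Second-sort values are confined to \<open>T\<close>, so \<open>J\<close> is finite
    and embeds into any infinite index type.\<close>
  define J where "J = (C1 \<rightarrow>\<^sub>E carrier G) \<times> (C2 \<rightarrow>\<^sub>E T)"
  have "finite J"
    unfolding J_def C1_def C2_def using C fin T(1) by (intro finite_cartesian_product finite_PiE) auto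
  then obtain \<iota> :: "((nat \<Rightarrow> 'a) \<times> (nat \<Rightarrow> 'b)) \<Rightarrow> 'i" where \<iota>: "inj_on \<iota> J"
    using arb_inj_on_finite_infinite by blast
  define I where "I = \<iota> ` J"
  define fi where "fi = (\<lambda>i. fst (inv_into J \<iota> i))"
  define si where "si = (\<lambda>i. snd (inv_into J \<iota> i))"
  have fisi: "fi i \<in> C1 \<rightarrow>\<^sub>E carrier G" "si i \<in> C2 \<rightarrow>\<^sub>E T" if "i \<in> I" for i
    using inv_into_into[of i \<iota> J] that by (auto simp: fi_def si_def I_def J_def)
  have fisi_mem: "fi i x \<in> carrier G" "si i y \<in> S" if "i \<in> I" "x \<in> C1" "y \<in> C2" for i x y
    using fisi[OF that(1)] that(2,3) T(2) by (auto simp: PiE_iff)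
  have index: "\<exists>i\<in>I. fi i = f \<and> si i = s" if "f \<in> C1 \<rightarrow>\<^sub>E carrier G" "s \<in> C2 \<rightarrow>\<^sub>E T" for f s
    using that \<iota> by (intro bexI[of _ "\<iota> (f, s)"]) (auto simp: fi_def si_def I_def J_def)
  \<comment> \<open>\<open>X x\<close> is a first-sort variable and \<open>E (w, y)\<close> the term
    \<open>w\<close> applied to \<open>y\<close>, each recorded as the tuple of its values under all
    assignments.\<close>
  define X where "X = (\<lambda>x. \<lambda>i\<in>I. Atom (fi i x) :: ('a, 'i) tower)"
  define E where "E = (\<lambda>(w, y). \<lambda>i\<in>I. Atom (\<alpha> (word_val G (fi i) w) (si i y)) :: ('b, 'i) tower)"
  define Q where "Q = {(w, y). set w \<subseteq> C1 \<and> y \<in> C2}"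
  let ?A = "copy2 Atom Atom (action_algebra G S \<alpha>) :: (('a, 'i) tower, ('b, 'i) tower) alg2"
  let ?P = "prod2 I (\<lambda>_. ?A)"
  let ?PP = "copy2 Tuple Tuple ?P"
  have PP: "?PP \<in> variety_closure {action_algebra G S \<alpha>}"
    by (intro variety_closure.prod variety_closure.base) auto
  have wv: "word_val G (fi i) w \<in> carrier G" if "i \<in> I" "(w, y) \<in> Q" for i w y
    using that fisi[of i] by (intro G.word_val_closed) (auto simp: Q_def PiE_iff)
  have \<alpha>_closed: "\<alpha> g s \<in> S" if "g \<in> carrier G" "s \<in> S" for g s
    using element_image[OF that] by simp
  have X: "X x \<in> sort1 ?P" if "x \<in> C1" for x
    using that C(2) fisi_mem by (auto simp: prod2_def X_def action_algebra_def PiE_iff everywhere_nonempty_def C1_def C2_def)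
  have E: "E z \<in> sort2 ?P" if "z \<in> Q" for z
  proof -
    obtain w y where z: "z = (w, y)" by (cases z)
    have "\<alpha> (word_val G (fi i) w) (si i y) \<in> S" if "i \<in> I" for i
    proof -
      have "si i y \<in> S" using fisi[OF that] T(2) \<open>z \<in> Q\<close> by (auto simp: Q_def z PiE_iff)
      then show ?thesis using wv[OF that] \<open>z \<in> Q\<close> z by (intro \<alpha>_closed) auto
    qed
    then show ?thesis by (auto simp: prod2_def E_def z action_algebra_def)
  qed
  have XE: "act ?PP (Tuple (X x)) (Tuple (E (w, y))) = Tuple (E (x # w, y))"
    if "x \<in> C1" "(w, y) \<in> Q" for x w y
  proof -
    have "act ?PP (Tuple (X x)) (Tuple (E (w, y))) = Tuple (act ?P (X x) (E (w, y)))"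
      using X[OF that(1)] E[OF that(2)] by (intro act_copy2) (auto intro: inj_onI)
    also have "act ?P (X x) (E (w, y)) = E (x # w, y)"
    proof
      fix i
      show "act ?P (X x) (E (w, y)) i = E (x # w, y) i"
      proof (cases "i \<in> I")
        case True
        have mem: "fi i x \<in> carrier G" "si i y \<in> S" "word_val G (fi i) w \<in> carrier G"
          using fisi_mem[OF True] wv[OF True that(2)] that by (auto simp: Q_def)
        have "act ?P (X x) (E (w, y)) i
            = act ?A (Atom (fi i x)) (Atom (\<alpha> (word_val G (fi i) w) (si i y)))"
          using True by (simp add: prod2_def X_def E_def)
        also have "\<dots> = Atom (\<alpha> (fi i x) (\<alpha> (word_val G (fi i) w) (si i y)))"
          using mem by (subst act_copy2) (auto simp: action_algebra_def intro: inj_onI \<alpha>_closed)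
        finally show ?thesis using True mem by (simp add: E_def composition_rule del: hom_mult)
      qed (simp add: prod2_def E_def)
    qed
    finally show ?thesis .
  qed
  \<comment> \<open>The subalgebra generated by the variables. The operation produces no first-sort
    elements, so that sort consists of the \<open>X x\<close> alone.\<close>
  define D where "D = \<lparr>sort1 = (\<lambda>x. Tuple (X x)) ` C1, sort2 = (\<lambda>z. Tuple (E z)) ` Q, act = act ?PP\<rparr>"
  have D: "algebra2 D"
    by (auto simp: algebra2_def D_def XE) (auto simp: Q_def)
  have "subalgebra2 D ?PP"
    using D X E by (auto simp: subalgebra2_def D_def)
  moreover have "everywhere_nonempty D"
    using C(2) by (auto simp: everywhere_nonempty_def D_def C1_def C2_def Q_def intro: exI[of _ "[]"])
  ultimately have DV: "D \<in> variety_closure {action_algebra G S \<alpha>}"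
    using PP by (metis variety_closure.sub)

  obtain f where f: "\<And>x. x \<in> C1 \<Longrightarrow> f (Tuple (X x)) = (nat_tower x :: ('a, 'i) tower)"
  proof (rule factor_through[of C1 "\<lambda>x. Tuple (X x)" "nat_tower :: nat \<Rightarrow> ('a, 'i) tower"])
    fix x x' assume x: "x \<in> C1" "x' \<in> C1" and eq: "Tuple (X x) = Tuple (X x')"
    have "x = x'"
    proof (rule ccontr)
      assume "x \<noteq> x'"
      \<comment> \<open>Sending \<open>x\<close> to \<open>g1\<close> and all other variables to
        \<open>\<one>\<close> separates \<open>x\<close> from \<open>x'\<close>.\<close>
      obtain i where "i \<in> I" "fi i = (\<lambda>z\<in>C1. if z = x then g1 else \<one>\<^bsub>G\<^esub>)"
        using index[of "\<lambda>z\<in>C1. if z = x then g1 else \<one>\<^bsub>G\<^esub>" "\<lambda>z\<in>C2. t0"] g1 t01 by auto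
      moreover have "X x i = X x' i" using eq by simp
      ultimately show False using x \<open>x \<noteq> x'\<close> g1 by (simp add: X_def)
    qed
    then show "nat_tower x = (nat_tower x' :: ('a, 'i) tower)" by simp
  qed blast
  obtain g where g: "\<And>z. z \<in> Q \<Longrightarrow>
    g (Tuple (E z)) = (nat_tower (case z of (w, y) \<Rightarrow> foldr (act C) w y) :: ('b, 'i) tower)"
  proof (rule factor_through[of Q "\<lambda>z. Tuple (E z)"
        "\<lambda>z. nat_tower (case z of (w, y) \<Rightarrow> foldr (act C) w y) :: ('b, 'i) tower"])
    fix z z' assume zz: "z \<in> Q" "z' \<in> Q" and eq: "Tuple (E z) = Tuple (E z')"
    obtain w y w' y' where z: "z = (w, y)" "z' = (w', y')" by (cases z; cases z')
    have w: "set w \<subseteq> C1" "set w' \<subseteq> C1" and y: "y \<in> C2" "y' \<in> C2"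
      using zz z by (auto simp: Q_def)
    have ev: "\<alpha> (word_val G f w) (s y) = \<alpha> (word_val G f w') (s y')"
      if "f \<in> C1 \<rightarrow>\<^sub>E carrier G" "s \<in> C2 \<rightarrow>\<^sub>E T" for f s
    proof -
      obtain i where "i \<in> I" "fi i = f" "si i = s" using index[OF \<open>f \<in> _\<close> \<open>s \<in> _\<close>] by blast
      moreover have "E z i = E z' i" using eq by simp
      ultimately show ?thesis by (simp add: E_def z)
    qed
    \<comment> \<open>With every first-sort variable at \<open>\<one>\<close> both words act
      trivially, so an assignment that separates \<open>y\<close> from \<open>y'\<close> would
      separate the two tuples.\<close>
    have "y = y'"
    proof (rule ccontr)
      assume "y \<noteq> y'"
      have one: "word_val G (\<lambda>z\<in>C1. \<one>\<^bsub>G\<^esub>) u = \<one>\<^bsub>G\<^esub>" if "set u \<subseteq> C1" for u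
        using that by (induction u) auto
      have "\<alpha> \<one>\<^bsub>G\<^esub> t0 = \<alpha> \<one>\<^bsub>G\<^esub> t1"
        using ev[of "\<lambda>z\<in>C1. \<one>\<^bsub>G\<^esub>" "\<lambda>z\<in>C2. if z = y then t0 else t1"] one w y \<open>y \<noteq> y'\<close> t01
        by simp
      then show False using id_eq_one t01 T(2) by (metis restrict_apply subsetD)
    qed
    \<comment> \<open>A constant second-sort assignment at \<open>t\<close> compares the two word
      values at \<open>t\<close>; as \<open>t\<close> runs through the separating set
      \<open>T\<close>, they coincide.\<close>
    have "law G w w'"
      unfolding law_def
    proof (intro allI impI)
      fix \<phi> :: "nat \<Rightarrow> 'a" assume \<phi>: "range \<phi> \<subseteq> carrier G"
      have \<phi>': "restrict \<phi> C1 \<in> C1 \<rightarrow>\<^sub>E carrier G" using \<phi> by auto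
      have eqs: "word_val G (restrict \<phi> C1) w = word_val G \<phi> w"
        "word_val G (restrict \<phi> C1) w' = word_val G \<phi> w'"
        using w by (auto intro!: word_val_cong)
      show "word_val G \<phi> w = word_val G \<phi> w'"
      proof (rule T(3))
        fix t assume "t \<in> T"
        then show "\<alpha> (word_val G \<phi> w) t = \<alpha> (word_val G \<phi> w') t"
          using ev[OF \<phi>', of "\<lambda>z\<in>C2. t"] y \<open>y = y'\<close> eqs by simp
      qed (use \<phi> in \<open>auto intro!: G.word_val_closed\<close>)
    qed
    then have "foldr (act C) w y = foldr (act C) w' y"
      using laws w y by (simp add: C1_def C2_def)
    then show "(nat_tower (case z of (w, y) \<Rightarrow> foldr (act C) w y) :: ('b, 'i) tower) =
        nat_tower (case z' of (w, y) \<Rightarrow> foldr (act C) w y)"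
      by (simp add: z \<open>y = y'\<close>)
  qed blast
  let ?C = "copy2 nat_tower nat_tower C :: (('a, 'i) tower, ('b, 'i) tower) alg2"
  have inj: "inj_on nat_tower A" for A using inj_nat_tower by (rule inj_on_subset) simp
  have closed: "foldr (act C) w y \<in> C2" if "(w, y) \<in> Q" for w y
    using that C(1) by (induction w) (auto simp: Q_def C1_def C2_def algebra2_def)
  have "hom2 D ?C f g"
    unfolding hom2_def
  proof (intro conjI ballI)
    show "algebra2 ?C" by (intro algebra2_copy2 C inj)
    show "f \<in> sort1 D \<rightarrow> sort1 ?C" by (auto simp: D_def f C1_def)
    show "g \<in> sort2 D \<rightarrow> sort2 ?C" using closed by (auto simp: D_def g C2_def)
    fix x y assume "x \<in> sort1 D" "y \<in> sort2 D"
    then obtain c w z where c: "c \<in> C1" "x = Tuple (X c)" and wz: "(w, z) \<in> Q" "y = Tuple (E (w, z))"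
      by (auto simp: D_def)
    have "(c # w, z) \<in> Q" using c wz by (auto simp: Q_def)
    then show "g (act D x y) = act ?C (f x) (g y)"
      using c wz closed[OF wz(1)]
      by (simp add: D_def XE f g act_copy2[OF inj inj] C1_def C2_def)
  qed (rule D)
  moreover have "f ` sort1 D = sort1 ?C"
    using f by (force simp: D_def C1_def)
  moreover have "g ` sort2 D = sort2 ?C"
  proof
    show "g ` sort2 D \<subseteq> sort2 ?C" using closed by (auto simp: D_def g C2_def)
    show "sort2 ?C \<subseteq> g ` sort2 D"
    proof
      fix t assume "t \<in> sort2 ?C"
      then obtain y where y: "y \<in> C2" "t = nat_tower y" by (auto simp: C2_def)
      then have Q: "([], y) \<in> Q" by (simp add: Q_def)
      then have "Tuple (E ([], y)) \<in> sort2 D" by (auto simp: D_def)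
      then show "t \<in> g ` sort2 D" using g[OF Q] y by force
    qed
  qed
  ultimately have "hom_image2 D ?C"
    unfolding hom_image2_def by blast
  with DV have "?C \<in> variety_closure {action_algebra G S \<alpha>}"
    by (rule variety_closure.image)
  moreover have "isomorphic2 ?C C" by (intro isomorphic2_copy2 C inj)
  ultimately show ?thesis unfolding in_variety_def by blast
qed

section \<open>Lower central series and normal subgroups\<close>

lemma (in group) lower_central_subgroup: "subgroup (lower_central G k) G"
proof (cases k)
  case (Suc j)
  have "lower_central G j \<subseteq> carrier G"
  proof (induction j)
    case (Suc j)
    then show ?case by (auto intro!: generate_incl)
  qed simp
  with Suc show ?thesis by (auto intro!: generate_is_subgroup)
qed (simp add: subgroup_self)

lemma (in group) lower_central_subset: "lower_central G k \<subseteq> carrier G"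
  using lower_central_subgroup by (rule subgroup.subset)

lemma (in group) commutator_in_lower_central:
  assumes "x \<in> lower_central G k" "y \<in> carrier G"
  shows "x \<otimes> y \<otimes> inv x \<otimes> inv y \<in> lower_central G (Suc k)"
  using assms by (auto intro!: generate.incl)

text \<open>Surjectivity lets every commutator in \<open>H\<close> be lifted to one in
  \<open>G\<close>.\<close>

lemma (in group_hom) lower_central_hom_image:
  assumes "h ` carrier G = carrier H"
  shows "lower_central H k = h ` lower_central G k"
proof (induction k)
  case (Suc k)
  let ?X = "{x \<otimes> y \<otimes> inv x \<otimes> inv y | x y. x \<in> lower_central G k \<and> y \<in> carrier G}"
  let ?Y = "{x \<otimes>\<^bsub>H\<^esub> y \<otimes>\<^bsub>H\<^esub> inv\<^bsub>H\<^esub> x \<otimes>\<^bsub>H\<^esub> inv\<^bsub>H\<^esub> y | x y.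
    x \<in> lower_central H k \<and> y \<in> carrier H}"
  have hc: "h (x \<otimes> y \<otimes> inv x \<otimes> inv y) = h x \<otimes>\<^bsub>H\<^esub> h y \<otimes>\<^bsub>H\<^esub> inv\<^bsub>H\<^esub> (h x) \<otimes>\<^bsub>H\<^esub> inv\<^bsub>H\<^esub> (h y)"
    if "x \<in> lower_central G k" "y \<in> carrier G" for x y
    using that G.lower_central_subset[of k] by (auto simp: subset_iff)
  have "?Y = h ` ?X"
  proof
    show "?Y \<subseteq> h ` ?X"
    proof
      fix z assume "z \<in> ?Y"
      then obtain x y where "x \<in> lower_central G k" "y \<in> carrier G"
        "z = h x \<otimes>\<^bsub>H\<^esub> h y \<otimes>\<^bsub>H\<^esub> inv\<^bsub>H\<^esub> (h x) \<otimes>\<^bsub>H\<^esub> inv\<^bsub>H\<^esub> (h y)"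
        unfolding Suc assms[symmetric] by blast
      then show "z \<in> h ` ?X" using hc by (intro image_eqI[of _ _ "x \<otimes> y \<otimes> inv x \<otimes> inv y"]) auto
    qed
    show "h ` ?X \<subseteq> ?Y"
    proof
      fix z assume "z \<in> h ` ?X"
      then obtain x y where "x \<in> lower_central G k" "y \<in> carrier G"
        "z = h (x \<otimes> y \<otimes> inv x \<otimes> inv y)" by blast
      then show "z \<in> ?Y" using hc[of x y] unfolding Suc assms[symmetric] by blast
    qed
  qed
  moreover have "?X \<subseteq> carrier G" using G.lower_central_subset[of k] by (auto simp: subset_iff)
  ultimately show ?case using generate_img[of ?X] by simp
qed (use assms in simp)

lemma (in group) commutator_eq_one_iff:
  assumes "x \<in> carrier G" "y \<in> carrier G"
  shows "x \<otimes> y \<otimes> inv x \<otimes> inv y = \<one> \<longleftrightarrow> x \<otimes> y = y \<otimes> x"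
proof -
  have "x \<otimes> y \<otimes> inv x \<otimes> inv y = (x \<otimes> y) \<otimes> inv (y \<otimes> x)"
    using assms by (simp add: m_assoc inv_mult_group)
  then show ?thesis using assms by (metis inv_solve_right' l_one m_closed one_closed)
qed

lemma (in group) nilpotent_if_commutative:
  assumes "\<And>x y. x \<in> carrier G \<Longrightarrow> y \<in> carrier G \<Longrightarrow> x \<otimes> y = y \<otimes> x"
  shows "nilpotent_group G"
proof -
  have "x \<otimes> y \<otimes> inv x \<otimes> inv y = \<one>" if "x \<in> carrier G" "y \<in> carrier G" for x y
    using assms[OF that] commutator_eq_one_iff[OF that] by blast
  then have "{x \<otimes> y \<otimes> inv x \<otimes> inv y | x y. x \<in> carrier G \<and> y \<in> carrier G} \<subseteq> {\<one>}" by auto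
  then have "lower_central G (Suc 0) \<subseteq> {\<one>}"
    using generate_subgroup_incl[OF _ triv_subgroup] by simp
  then have "lower_central G (Suc 0) = {\<one>}"
    using subgroup.one_closed[OF lower_central_subgroup[of "Suc 0"]] by blast
  then show ?thesis unfolding nilpotent_group_def using group_axioms by blast
qed

text \<open>Some term of the lower central series of \<open>G\<close> maps to the identity, so it
  lies in the central subgroup \<open>N\<close>; the next term is then generated by trivial
  commutators.\<close>

lemma (in group) nilpotent_if_mod_central_nilpotent:
  assumes f: "weak_group_morphism f N G" and nil: "nilpotent_group (image_group f G)"
    and central: "\<And>x z. x \<in> carrier G \<Longrightarrow> z \<in> N \<Longrightarrow> x \<otimes> z = z \<otimes> x"
  shows "nilpotent_group G"
proof -
  interpret weak_group_morphism f N G by (rule f)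
  interpret H: group_hom G "image_group f G" f by (rule weak_group_morphism_group_hom[OF f])
  obtain k where k: "lower_central (image_group f G) k = {f \<one>}"
    using nil unfolding nilpotent_group_def image_group_one by blast
  have "f ` lower_central G k = {f \<one>}"
    using H.lower_central_hom_image[of k] k by (simp add: image_group_carrier)
  then have N: "z \<in> N" if "z \<in> lower_central G k" for z
    using that inj_mod_subgroup[of z \<one>] lower_central_subset[of k] by auto
  have "x \<otimes> y \<otimes> inv x \<otimes> inv y = \<one>" if "x \<in> lower_central G k" "y \<in> carrier G" for x y
  proof -
    have "x \<in> carrier G" using that lower_central_subset by blast
    then show ?thesis
      using central[OF that(2) N[OF that(1)]] commutator_eq_one_iff[OF _ that(2)] by simp
  qed
  then have "{x \<otimes> y \<otimes> inv x \<otimes> inv y | x y. x \<in> lower_central G k \<and> y \<in> carrier G} \<subseteq> {\<one>}" by auto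
  then have "lower_central G (Suc k) \<subseteq> {\<one>}"
    using generate_subgroup_incl[OF _ triv_subgroup] by simp
  then have "lower_central G (Suc k) = {\<one>}"
    using subgroup.one_closed[OF lower_central_subgroup[of "Suc k"]] by blast
  then show ?thesis unfolding nilpotent_group_def using group_axioms by blast
qed

text \<open>Take the first term of the lower central series inside \<open>I\<close>. Commutators of
  the preceding term with \<open>I\<close> fall into \<open>I\<close>, so that term normalizes
  \<open>I\<close>, and it contains an element outside \<open>I\<close>.\<close>

lemma (in group) nilpotent_normalizer_grows:
  assumes "nilpotent_group G" "subgroup I G" "I \<noteq> carrier G"
  obtains x where "x \<in> carrier G" "x \<notin> I"
    "\<And>i. i \<in> I \<Longrightarrow> x \<otimes> i \<otimes> inv x \<in> I" "\<And>i. i \<in> I \<Longrightarrow> inv x \<otimes> i \<otimes> x \<in> I"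
proof -
  interpret I: subgroup I G by (rule assms)
  obtain k0 where "lower_central G k0 = {\<one>}" using assms(1) by (auto simp: nilpotent_group_def)
  then have "\<exists>k. lower_central G k \<subseteq> I" using I.one_closed by (intro exI[of _ k0]) simp
  then obtain k where k: "lower_central G k \<subseteq> I" "\<And>j. j < k \<Longrightarrow> \<not> lower_central G j \<subseteq> I"
    using exists_least_iff[of "\<lambda>k. lower_central G k \<subseteq> I"] by blast
  obtain j where j: "k = Suc j"
    using k(1) assms(3) I.subset by (cases k) auto
  obtain x where x: "x \<in> lower_central G j" "x \<notin> I" using k(2)[of j] j by auto
  have xG: "x \<in> carrier G" using x lower_central_subset by blast
  have conj: "y \<otimes> i \<otimes> inv y \<in> I" if "y \<in> lower_central G j" "i \<in> I" for y i
  proof -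
    have yG: "y \<in> carrier G" using that lower_central_subset by blast
    have "y \<otimes> i \<otimes> inv y \<otimes> inv i \<in> I"
      using commutator_in_lower_central[OF that(1), of i] that(2) k(1) j by auto
    then have "(y \<otimes> i \<otimes> inv y \<otimes> inv i) \<otimes> i \<in> I" using that(2) by (rule I.m_closed)
    then show ?thesis using yG that(2) by (simp add: m_assoc)
  qed
  have "inv x \<in> lower_central G j"
    using subgroup.m_inv_closed[OF lower_central_subgroup] x(1) by blast
  then have "inv x \<otimes> i \<otimes> x \<in> I" if "i \<in> I" for i using conj[of "inv x" i] that xG by simp
  with xG x conj show ?thesis by (intro that) auto
qed

text \<open>The last nontrivial term of the lower central series is central.\<close>

lemma (in group) nilpotent_center_nontrivial:
  assumes "nilpotent_group G" "carrier G \<noteq> {\<one>}"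
  obtains z where "z \<in> carrier G" "z \<noteq> \<one>" "\<And>x. x \<in> carrier G \<Longrightarrow> x \<otimes> z = z \<otimes> x"
proof -
  obtain k where k: "lower_central G k = {\<one>}" "\<And>j. j < k \<Longrightarrow> lower_central G j \<noteq> {\<one>}"
    using assms(1) exists_least_iff[of "\<lambda>k. lower_central G k = {\<one>}"]
    by (auto simp: nilpotent_group_def)
  obtain j where j: "k = Suc j" using k(1) assms(2) by (cases k) auto
  obtain z where z: "z \<in> lower_central G j" "z \<noteq> \<one>"
    using k(2)[of j] j subgroup.one_closed[OF lower_central_subgroup[of j]] by blast
  have zG: "z \<in> carrier G" using z lower_central_subset by blast
  have "x \<otimes> z = z \<otimes> x" if "x \<in> carrier G" for x
    using commutator_in_lower_central[OF z(1) that] k(1) j commutator_eq_one_iff[OF zG that] by auto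
  with z zG show ?thesis by (intro that) auto
qed

section \<open>Passing laws to quotients and subgroups\<close>

lemma (in group_hom) law_hom_image:
  assumes "h ` carrier G = carrier H" "law G w w'"
  shows "law H w w'"
  unfolding law_def
proof (intro allI impI)
  fix \<phi> :: "nat \<Rightarrow> 'c" assume \<phi>: "range \<phi> \<subseteq> carrier H"
  define \<psi> where "\<psi> = (\<lambda>i. inv_into (carrier G) h (\<phi> i))"
  have "\<phi> i \<in> h ` carrier G" for i using \<phi> assms by auto
  then have "range \<psi> \<subseteq> carrier G" "(\<lambda>i. h (\<psi> i)) = \<phi>"
    by (auto simp: \<psi>_def inv_into_into f_inv_into_f)
  then show "word_val H \<phi> w = word_val H \<phi> w'"
    using word_val_hom[of \<psi> w] word_val_hom[of \<psi> w'] assms(2) by (simp add: law_def)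
qed

lemma law_subgroup:
  assumes "subgroup U G" "law G w w'"
  shows "law (G\<lparr>carrier := U\<rparr>) w w'"
proof -
  have "word_val (G\<lparr>carrier := U\<rparr>) \<phi> w = word_val G \<phi> w" for \<phi> w
    by (simp add: word_val_def)
  then show ?thesis using assms subgroup.subset[OF assms(1)] by (auto simp: law_def)
qed

text \<open>Sending an element to a chosen member of its coset models the quotient by
  \<open>N\<close> on the same type, as a minimality argument over groups of one type
  requires.\<close>

lemma (in group) exists_weak_group_morphism:
  assumes "N \<lhd> G"
  obtains f :: "'a \<Rightarrow> 'a" where "weak_group_morphism f N G"
proof
  interpret normal N G by (rule assms)
  let ?f = "\<lambda>a. SOME z. z \<in> N #> a"
  show "weak_group_morphism ?f N G"
  proof (rule weak_group_morphismsI[OF assms])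
    fix a b assume ab: "a \<in> carrier G" "b \<in> carrier G"
    have mem: "?f x \<in> N #> x" if "x \<in> carrier G" for x
      using rcos_self[OF that is_subgroup] by (rule someI)
    have "N #> a = N #> b" if "?f a = ?f b"
      using mem[OF ab(1)] mem[OF ab(2)] that ab repr_independence[OF _ _ is_subgroup] by metis
    then have "?f a = ?f b \<longleftrightarrow> N #> a = N #> b" by auto
    also have "\<dots> \<longleftrightarrow> a \<otimes> inv b \<in> N"
      using ab is_subgroup rcos_module[OF is_group ab(2,1)] rcos_self repr_independence by metis
    finally show "?f a = ?f b \<longleftrightarrow> a \<otimes> inv b \<in> N" .
  qed
qed

section \<open>Minimal non-nilpotent groups\<close>

context group
begin

definition conjugate :: "'a \<Rightarrow> 'a \<Rightarrow> 'a" where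
  "conjugate x y = x \<otimes> y \<otimes> inv x"

lemma conjugate_closed [simp]: "x \<in> carrier G \<Longrightarrow> y \<in> carrier G \<Longrightarrow> conjugate x y \<in> carrier G"
  by (simp add: conjugate_def)

lemma conjugate_one [simp]: "x \<in> carrier G \<Longrightarrow> conjugate x \<one> = \<one>" "y \<in> carrier G \<Longrightarrow> conjugate \<one> y = y"
  by (simp_all add: conjugate_def)

lemma conjugate_mult:
  "x \<in> carrier G \<Longrightarrow> y \<in> carrier G \<Longrightarrow> z \<in> carrier G \<Longrightarrow>
    conjugate (x \<otimes> y) z = conjugate x (conjugate y z)"
  by (simp add: conjugate_def m_assoc inv_mult_group)

lemma conjugate_inv [simp]:
  assumes "x \<in> carrier G" "y \<in> carrier G"
  shows "conjugate x (conjugate (inv x) y) = y" "conjugate (inv x) (conjugate x y) = y"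
  using assms by (simp_all add: conjugate_mult[symmetric])

lemma conjugate_hom: "x \<in> carrier G \<Longrightarrow> group_hom G G (conjugate x)"
proof
  show "x \<in> carrier G \<Longrightarrow> conjugate x \<in> hom G G"
    by (rule homI) (simp_all add: conjugate_def m_assoc, simp add: m_assoc[symmetric])
qed

lemma conjugate_eq_one_iff [simp]:
  assumes "x \<in> carrier G" "y \<in> carrier G"
  shows "conjugate x y = \<one> \<longleftrightarrow> y = \<one>"
  by (metis assms conjugate_inv(2) conjugate_one(1) inv_closed)

lemma conjugate_eq_self_iff:
  assumes "x \<in> carrier G" "y \<in> carrier G"
  shows "conjugate x y = y \<longleftrightarrow> x \<otimes> y = y \<otimes> x"
  using assms by (metis conjugate_def inv_solve_right m_closed)

lemma normalI_conjugate:
  assumes "subgroup N G" "\<And>x n. x \<in> carrier G \<Longrightarrow> n \<in> N \<Longrightarrow> conjugate x n \<in> N"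
  shows "N \<lhd> G"
  using assms normal_inv_iff by (auto simp: conjugate_def)

text \<open>The normalizer of \<open>I\<close>. Asking for both conjugations makes closure under
  inverses immediate.\<close>

definition normalizing :: "'a set \<Rightarrow> 'a set" where
  "normalizing I = {x \<in> carrier G. \<forall>i\<in>I. conjugate x i \<in> I \<and> conjugate (inv x) i \<in> I}"

lemma normalizing_subgroup:
  assumes "subgroup I G" shows "subgroup (normalizing I) G"
proof (rule subgroupI)
  show "normalizing I \<subseteq> carrier G" by (auto simp: normalizing_def)
  have IG: "i \<in> carrier G" if "i \<in> I" for i using that subgroup.subset[OF assms] by blast
  then have "\<one> \<in> normalizing I" by (simp add: normalizing_def)
  then show "normalizing I \<noteq> {}" by blast
  show "inv a \<in> normalizing I" if "a \<in> normalizing I" for a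
    using that by (auto simp: normalizing_def)
  show "a \<otimes> b \<in> normalizing I" if "a \<in> normalizing I" "b \<in> normalizing I" for a b
    using that IG by (auto simp: normalizing_def conjugate_mult inv_mult_group)
qed

lemma subset_normalizing:
  assumes "subgroup I G" shows "I \<subseteq> normalizing I"
proof
  interpret subgroup I G by (rule assms)
  fix x assume "x \<in> I"
  then show "x \<in> normalizing I" by (auto simp: normalizing_def conjugate_def)
qed

lemma normal_if_normalizing:
  assumes "subgroup I G" "normalizing I = carrier G" shows "I \<lhd> G"
  using assms by (auto intro!: normalI_conjugate simp: normalizing_def)

definition conjugates :: "'a set \<Rightarrow> 'a set" where
  "conjugates M = (\<lambda>(x, m). conjugate x m) ` (carrier G \<times> (M - {\<one>}))"

text \<open>Each element of the union is hit by exactly \<open>card M\<close> pairs \<open>(x, m)\<close>: since distinct conjugates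
  of \<open>M\<close> meet trivially, \<open>x\<close> is determined up to a left coset of \<open>M\<close>.\<close>

lemma card_conjugates:
  assumes fin: "finite (carrier G)" and M: "subgroup M G"
    and TI: "\<And>x m. x \<in> carrier G \<Longrightarrow> m \<in> M \<Longrightarrow> m \<noteq> \<one> \<Longrightarrow> conjugate x m \<in> M \<Longrightarrow> x \<in> M"
  shows "card (conjugates M) * card M = order G * (card M - 1)"
proof -
  interpret M: subgroup M G by (rule M)
  let ?A = "carrier G \<times> (M - {\<one>})"
  let ?F = "\<lambda>(x, m). conjugate x m"
  have finM: "finite M" using fin M.subset by (rule rev_finite_subset)
  have finA: "finite ?A" using fin finM by blast
  have fiber: "card {a \<in> ?A. ?F a = u} = card M" if u: "u \<in> conjugates M" for u
  proof -
    obtain x m where xm: "x \<in> carrier G" "m \<in> M" "m \<noteq> \<one>" "u = conjugate x m"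
      using u by (auto simp: conjugates_def)
    have "bij_betw (\<lambda>t. (x \<otimes> t, conjugate (inv t) m)) M {a \<in> ?A. ?F a = u}"
      unfolding bij_betw_def
    proof
      show "inj_on (\<lambda>t. (x \<otimes> t, conjugate (inv t) m)) M" using xm by (auto intro!: inj_onI)
      show "(\<lambda>t. (x \<otimes> t, conjugate (inv t) m)) ` M = {a \<in> ?A. ?F a = u}"
      proof (intro equalityI subsetI)
        fix a assume "a \<in> (\<lambda>t. (x \<otimes> t, conjugate (inv t) m)) ` M"
        then obtain t where t: "t \<in> M" "a = (x \<otimes> t, conjugate (inv t) m)" by blast
        have "conjugate (inv t) m \<in> M" using t xm by (simp add: conjugate_def)
        then show "a \<in> {a \<in> ?A. ?F a = u}" using t xm by (auto simp: conjugate_mult)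
      next
        fix a assume "a \<in> {a \<in> ?A. ?F a = u}"
        then obtain y k where y: "a = (y, k)" "y \<in> carrier G" "k \<in> M" "k \<noteq> \<one>" "conjugate y k = u"
          by auto
        define t where "t = inv x \<otimes> y"
        have t: "t \<in> carrier G" using xm y by (simp add: t_def)
        have "conjugate t k = m" using xm y by (simp add: t_def conjugate_mult)
        then have "t \<in> M" using TI[OF t y(3,4)] xm by simp
        moreover have "conjugate (inv t) m = k" using \<open>conjugate t k = m\<close> t y by auto
        moreover have "x \<otimes> t = y" using xm y by (simp add: t_def m_assoc[symmetric])
        ultimately show "a \<in> (\<lambda>t. (x \<otimes> t, conjugate (inv t) m)) ` M"
          using y(1) by (intro image_eqI[of _ _ t]) auto
      qed
    qed
    then show ?thesis by (rule bij_betw_same_card[symmetric])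
  qed
  have "card ?A = (\<Sum>a\<in>?A. 1)" by simp
  also have "\<dots> = (\<Sum>u\<in>conjugates M. \<Sum>a\<in>{a \<in> ?A. ?F a = u}. 1)"
    using finA by (intro sum.group[symmetric]) (auto simp: conjugates_def)
  also have "\<dots> = (\<Sum>u\<in>conjugates M. card M)" using fiber by (intro sum.cong) simp_all
  finally show ?thesis using finM M.one_closed by (simp add: order_def card_cartesian_product)
qed

section \<open>Maximal subgroups\<close>

definition maximal_subgroup :: "'a set \<Rightarrow> bool" where
  "maximal_subgroup M \<longleftrightarrow> subgroup M G \<and> M \<noteq> carrier G \<and>
     (\<forall>T. subgroup T G \<and> M \<subseteq> T \<longrightarrow> T = M \<or> T = carrier G)"

lemma ex_maximal_subgroup:
  assumes "finite (carrier G)" "subgroup H G" "H \<noteq> carrier G"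
  obtains M where "maximal_subgroup M" "H \<subseteq> M"
proof -
  define F where "F = {T. subgroup T G \<and> T \<noteq> carrier G \<and> H \<subseteq> T}"
  have "F \<subseteq> Pow (carrier G)" using subgroup.subset by (auto simp: F_def)
  then have "finite F" using assms(1) by (simp add: finite_subset)
  moreover have "H \<in> F" using assms by (simp add: F_def)
  ultimately obtain M where M: "M \<in> F" "\<forall>T\<in>F. M \<subseteq> T \<longrightarrow> M = T"
    using finite_has_maximal2 by metis
  then have "maximal_subgroup M" by (auto simp: maximal_subgroup_def F_def)
  with M show ?thesis by (intro that) (auto simp: F_def)
qed

lemma maximal_subgroup_conjugate:
  assumes "maximal_subgroup M" "x \<in> carrier G"
  shows "maximal_subgroup (conjugate x ` M)"
proof -
  interpret M: subgroup M G using assms by (simp add: maximal_subgroup_def)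
  interpret c: group_hom G G "conjugate x" by (rule conjugate_hom[OF assms(2)])
  interpret c': group_hom G G "conjugate (inv x)" by (rule conjugate_hom) (use assms in simp)
  have img: "conjugate (inv x) ` conjugate x ` A = A" "conjugate x ` conjugate (inv x) ` A = A"
    if "A \<subseteq> carrier G" for A
    using that assms(2) by (force simp: image_image subset_iff)+
  have G: "conjugate x ` carrier G = carrier G"
  proof
    show "carrier G \<subseteq> conjugate x ` carrier G"
    proof
      fix y assume "y \<in> carrier G"
      then show "y \<in> conjugate x ` carrier G"
        using assms(2) by (intro image_eqI[of _ _ "conjugate (inv x) y"]) auto
    qed
  qed (use assms(2) in auto)
  have "conjugate x ` M \<noteq> carrier G"
  proof
    assume eq: "conjugate x ` M = carrier G"
    have "conjugate (inv x) ` carrier G = M" using img(1)[OF M.subset] eq by simp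
    moreover have "conjugate (inv x) ` carrier G = carrier G" using img(1)[of "carrier G"] G by simp
    ultimately show False using assms(1) by (simp add: maximal_subgroup_def)
  qed
  moreover have "T = conjugate x ` M \<or> T = carrier G" if T: "subgroup T G" "conjugate x ` M \<subseteq> T" for T
  proof -
    have TG: "T \<subseteq> carrier G" using T subgroup.subset by blast
    have "M \<subseteq> conjugate (inv x) ` T" using T(2) img(1)[OF M.subset] by blast
    moreover have "subgroup (conjugate (inv x) ` T) G" using T c'.subgroup_img_is_subgroup by blast
    ultimately have "conjugate (inv x) ` T = M \<or> conjugate (inv x) ` T = carrier G"
      using assms(1) by (simp add: maximal_subgroup_def)
    then show ?thesis using img(2)[OF TG] G by metis
  qed
  ultimately show ?thesis
    using c.subgroup_img_is_subgroup[OF M.subgroup_axioms] by (simp add: maximal_subgroup_def)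
qed

text \<open>Suppose \<open>A \<noteq> B\<close> are maximal with \<open>A \<inter> B\<close>
  nontrivial and as large as possible, and let \<open>T\<close> be a maximal subgroup above the
  normalizer of \<open>A \<inter> B\<close>, which is proper by simplicity. Normalizers grow in the
  nilpotent groups \<open>A\<close> and \<open>B\<close>, so \<open>T\<close> meets each of them in
  more than \<open>A \<inter> B\<close>; by the choice of \<open>A\<close> and \<open>B\<close>,
  \<open>T\<close> equals both.\<close>

lemma maximal_subgroups_meet_trivially:
  assumes fin: "finite (carrier G)"
    and nil: "\<And>H. subgroup H G \<Longrightarrow> H \<noteq> carrier G \<Longrightarrow> nilpotent_group (G\<lparr>carrier := H\<rparr>)"
    and simple: "\<And>N. N \<lhd> G \<Longrightarrow> N = {\<one>} \<or> N = carrier G"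
    and MM: "maximal_subgroup M" "maximal_subgroup M'" "M \<noteq> M'"
  shows "M \<inter> M' = {\<one>}"
proof (rule ccontr)
  assume nontriv: "M \<inter> M' \<noteq> {\<one>}"
  let ?P = "\<lambda>k. \<exists>M M'. maximal_subgroup M \<and> maximal_subgroup M' \<and> M \<noteq> M' \<and> card (M \<inter> M') = k \<and> M \<inter> M' \<noteq> {\<one>}"
  have bound: "card (M \<inter> M') \<le> order G" if "maximal_subgroup M" for M M'
  proof -
    have "M \<subseteq> carrier G" using that subgroup.subset by (auto simp: maximal_subgroup_def)
    then show ?thesis unfolding order_def using fin by (intro card_mono) auto
  qed
  have "?P (card (M \<inter> M'))" using MM nontriv by blast
  moreover have "\<forall>k. ?P k \<longrightarrow> k \<le> order G" using bound by blast
  ultimately obtain k where k: "?P k" "\<forall>j. ?P j \<longrightarrow> j \<le> k"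
    using Nat.ex_has_greatest_nat[of ?P "card (M \<inter> M')" "order G"] by blast
  then obtain A B where AB: "maximal_subgroup A" "maximal_subgroup B" "A \<noteq> B" "card (A \<inter> B) = k"
    "A \<inter> B \<noteq> {\<one>}" by blast
  let ?I = "A \<inter> B"
  have sub: "subgroup A G" "subgroup B G" using AB by (auto simp: maximal_subgroup_def)
  then have I: "subgroup ?I G" by (rule subgroups_Inter_pair)
  have AG: "A \<subseteq> carrier G" using sub subgroup.subset by blast
  have "normalizing ?I \<noteq> carrier G"
  proof
    assume "normalizing ?I = carrier G"
    then have "?I \<lhd> G" using I by (intro normal_if_normalizing)
    then have "?I = carrier G" using simple AB(5) by blast
    then show False using AB(1) AG by (auto simp: maximal_subgroup_def)
  qed
  then obtain T where T: "maximal_subgroup T" "normalizing ?I \<subseteq> T"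
    using ex_maximal_subgroup[OF fin normalizing_subgroup[OF I]] by blast
  have "T = X" if X: "X = A \<or> X = B" for X
  proof (rule ccontr)
    assume "T \<noteq> X"
    have Xmax: "maximal_subgroup X" and IX: "?I \<subseteq> X" using X AB by auto
    then have Xsub: "subgroup X G" and XG: "X \<noteq> carrier G" by (auto simp: maximal_subgroup_def)
    interpret X: subgroup X G by (rule Xsub)
    interpret GX: group "G\<lparr>carrier := X\<rparr>" by (rule subgroup.subgroup_is_group[OF Xsub is_group])
    have "?I \<noteq> X"
    proof
      assume "?I = X"
      then have "A \<subseteq> B \<or> B \<subseteq> A" using X by blast
      then show False using AB(1,2,3) by (auto simp: maximal_subgroup_def)
    qed
    moreover have "subgroup ?I (G\<lparr>carrier := X\<rparr>)"
      using I IX Xsub by (simp add: subgroup_incl)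
    ultimately obtain x where x: "x \<in> X" "x \<notin> ?I"
      "\<And>i. i \<in> ?I \<Longrightarrow> x \<otimes> i \<otimes> inv\<^bsub>G\<lparr>carrier := X\<rparr>\<^esub> x \<in> ?I"
      "\<And>i. i \<in> ?I \<Longrightarrow> inv\<^bsub>G\<lparr>carrier := X\<rparr>\<^esub> x \<otimes> i \<otimes> x \<in> ?I"
      using GX.nilpotent_normalizer_grows[OF nil[OF Xsub XG], of ?I] by auto
    have inv: "inv\<^bsub>G\<lparr>carrier := X\<rparr>\<^esub> x = inv x" by (rule m_inv_consistent[OF Xsub x(1)])
    have "x \<in> normalizing ?I" using x inv X.mem_carrier by (simp add: normalizing_def conjugate_def)
    then have "x \<in> T \<inter> X" using T x by blast
    moreover have "?I \<subseteq> T \<inter> X" using subset_normalizing[OF I] T IX by blast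
    ultimately have "?I \<subset> T \<inter> X" using x by blast
    moreover have "finite (T \<inter> X)" using fin X.subset by (meson finite_subset inf_le2)
    ultimately have "card ?I < card (T \<inter> X)" by (intro psubset_card_mono)
    moreover have "T \<inter> X \<noteq> {\<one>}"
      using \<open>?I \<subseteq> T \<inter> X\<close> subgroup.one_closed[OF I] AB(5) by blast
    moreover from this have "card (T \<inter> X) \<le> k" using k(2) T(1) Xmax \<open>T \<noteq> X\<close> by blast
    ultimately show False using AB(4) by linarith
  qed
  then show False using AB(3) by blast
qed

text \<open>In a simple counterexample distinct maximal subgroups meet trivially and a nontrivial
  one is its own normalizer. So the conjugates of \<open>M\<close> contain \<open>order G\<close>
  minus the index of \<open>M\<close> nonidentity elements, at least half of the group, and miss
  some \<open>z \<noteq> \<one>\<close>. A maximal subgroup containing \<open>z\<close> yields a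
  second disjoint set with at least half of the elements, although the identity lies in
  neither.\<close>

lemma ex_proper_normal_subgroup:
  assumes fin: "finite (carrier G)" and nn: "\<not> nilpotent_group G"
    and nil: "\<And>H. subgroup H G \<Longrightarrow> H \<noteq> carrier G \<Longrightarrow> nilpotent_group (G\<lparr>carrier := H\<rparr>)"
  obtains N where "N \<lhd> G" "N \<noteq> {\<one>}" "N \<noteq> carrier G"
proof (rule ccontr)
  assume "\<not> thesis"
  with that have simple: "\<And>N. N \<lhd> G \<Longrightarrow> N = {\<one>} \<or> N = carrier G" by blast
  have meet: "M \<inter> M' = {\<one>}" if "maximal_subgroup M" "maximal_subgroup M'" "M \<noteq> M'" for M M'
    using maximal_subgroups_meet_trivially[OF fin _ _ that] nil simple by blast
  have in_max: "\<exists>M. maximal_subgroup M \<and> x \<in> M" if x: "x \<in> carrier G" for x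
  proof -
    \<comment> \<open>A cyclic group is abelian, hence nilpotent, so \<open>x\<close> generates a
      proper subgroup.\<close>
    have "generate G {x} \<noteq> carrier G"
    proof
      assume eq: "generate G {x} = carrier G"
      have "a \<otimes> b = b \<otimes> a" if ab: "a \<in> carrier G" "b \<in> carrier G" for a b
      proof -
        obtain i j :: int where "a = x [^] i" "b = x [^] j"
          using ab generate_pow[OF x] eq by blast
        then show ?thesis using x by (simp add: int_pow_mult[symmetric] add.commute)
      qed
      then show False using nn nilpotent_if_commutative by blast
    qed
    then obtain M where "maximal_subgroup M" "generate G {x} \<subseteq> M"
      using ex_maximal_subgroup[OF fin generate_is_subgroup] x by blast
    then show ?thesis using generate.incl[of x "{x}" G] by blast
  qed
  have TI: "x \<in> M" if M: "maximal_subgroup M" and x: "x \<in> carrier G"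
    and m: "m \<in> M" "m \<noteq> \<one>" "conjugate x m \<in> M" for M x m
  proof -
    have Msub: "subgroup M G" using M by (simp add: maximal_subgroup_def)
    interpret M: subgroup M G by (rule Msub)
    \<comment> \<open>A conjugate of \<open>M\<close> that meets \<open>M\<close> nontrivially is
      \<open>M\<close> itself, so \<open>x\<close> normalizes \<open>M\<close>; a maximal subgroup
      that is not normal is its own normalizer.\<close>
    have "conjugate x m \<in> M \<inter> conjugate x ` M" "conjugate x m \<noteq> \<one>" using m x by auto
    then have eq: "conjugate x ` M = M"
      using meet[OF M maximal_subgroup_conjugate[OF M x]] by blast
    have "conjugate (inv x) ` M = M"
    proof -
      have "conjugate (inv x) ` conjugate x ` M = M" using x by (force simp: image_image)
      then show ?thesis using eq by simp
    qed
    then have xn: "x \<in> normalizing M" using eq x by (auto simp: normalizing_def)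
    have "normalizing M = M \<or> normalizing M = carrier G"
      using M normalizing_subgroup[OF Msub] subset_normalizing[OF Msub] by (simp add: maximal_subgroup_def)
    moreover have "normalizing M \<noteq> carrier G"
    proof
      assume "normalizing M = carrier G"
      then have "M \<lhd> G" by (rule normal_if_normalizing[OF Msub])
      then have "M = {\<one>}" using simple M by (auto simp: maximal_subgroup_def)
      then show False using m by blast
    qed
    ultimately show ?thesis using xn by blast
  qed
  have count: "\<exists>c. 2 \<le> c \<and> 2 * c \<le> order G \<and> card (conjugates M) + c = order G"
    if M: "maximal_subgroup M" and m: "m \<in> M" "m \<noteq> \<one>" for M m
  proof -
    have Msub: "subgroup M G" and MG: "M \<noteq> carrier G" using M by (auto simp: maximal_subgroup_def)
    interpret M: subgroup M G by (rule Msub)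
    have finM: "finite M" using fin M.subset by (rule rev_finite_subset)
    have M2: "2 \<le> card M"
    proof -
      have "card {\<one>, m} \<le> card M" using m finM by (intro card_mono) auto
      then show ?thesis using m by simp
    qed
    have MltG: "card M < order G"
      unfolding order_def using M.subset MG fin by (intro psubset_card_mono) auto
    let ?c = "card (rcosets M)"
    have c: "?c * card M = order G" by (rule lagrange[OF Msub])
    have "card (conjugates M) * card M = order G * (card M - 1)"
      by (rule card_conjugates[OF fin Msub TI[OF M]])
    also have "\<dots> = ?c * (card M - 1) * card M" using c[symmetric] by simp
    finally have "card (conjugates M) = ?c * (card M - 1)" using M2 by simp
    then have "card (conjugates M) + ?c = order G"
      using c M2 by (cases "card M") auto
    moreover have "2 \<le> ?c"
    proof (rule ccontr)
      assume "\<not> 2 \<le> ?c"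
      then have "?c = 0 \<or> ?c = 1" by linarith
      then show False using c MltG by auto
    qed
    moreover have "2 * ?c \<le> order G" using c M2 by (metis mult.commute mult_le_mono1)
    ultimately show ?thesis by blast
  qed
  have conj_sub: "conjugates M \<subseteq> carrier G - {\<one>}" if "maximal_subgroup M" for M
    using that subgroup.subset[of M G] by (auto simp: conjugates_def maximal_subgroup_def subset_iff)
  obtain y where y: "y \<in> carrier G" "y \<noteq> \<one>"
    using nn nilpotent_if_commutative by (metis l_one r_one)
  obtain M where M: "maximal_subgroup M" "y \<in> M" using in_max y by blast
  obtain c where c: "2 \<le> c" "2 * c \<le> order G" "card (conjugates M) + c = order G"
    using count M y by blast
  have "insert \<one> (conjugates M) \<noteq> carrier G"
  proof
    assume "insert \<one> (conjugates M) = carrier G"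
    moreover have "finite (conjugates M)" using conj_sub[OF M(1)] fin by (meson finite_Diff finite_subset)
    ultimately have "order G \<le> Suc (card (conjugates M))"
      unfolding order_def by (metis card_insert_le_m1 card_insert_if le_SucI order_refl)
    then show False using c by linarith
  qed
  then obtain z where z: "z \<in> carrier G" "z \<noteq> \<one>" "z \<notin> conjugates M"
    using conj_sub[OF M(1)] by blast
  obtain M' where M': "maximal_subgroup M'" "z \<in> M'" using in_max z by blast
  obtain c' where c': "2 \<le> c'" "2 * c' \<le> order G" "card (conjugates M') + c' = order G"
    using count M' z by blast
  \<comment> \<open>A common element would make \<open>M'\<close> conjugate to \<open>M\<close> and
    put \<open>z\<close> into a conjugate of \<open>M\<close>.\<close>
  have disj: "conjugates M \<inter> conjugates M' = {}"
  proof (rule ccontr)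
    assume "conjugates M \<inter> conjugates M' \<noteq> {}"
    then obtain a b m m' where ab: "a \<in> carrier G" "b \<in> carrier G" "m \<in> M" "m' \<in> M'" "m \<noteq> \<one>"
      and eq: "conjugate a m = conjugate b m'" by (auto simp: conjugates_def)
    have MG: "M \<subseteq> carrier G" "M' \<subseteq> carrier G"
      using M M' subgroup.subset by (auto simp: maximal_subgroup_def)
    define x where "x = inv b \<otimes> a"
    have x: "x \<in> carrier G" using ab by (simp add: x_def)
    have mG: "m \<in> carrier G" "m' \<in> carrier G" using ab MG by auto
    have "conjugate x m = m'" using ab mG eq by (simp add: x_def conjugate_mult)
    then have "m' \<in> conjugate x ` M \<inter> M'" "m' \<noteq> \<one>" using ab x mG by auto
    then have "conjugate x ` M = M'"
      using meet[OF maximal_subgroup_conjugate[OF M(1) x] M'(1)] by blast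
    then obtain n where "n \<in> M" "z = conjugate x n" using M' by blast
    moreover from this have "n \<noteq> \<one>" using z x by auto
    ultimately have "z \<in> conjugates M" using x by (auto simp: conjugates_def)
    then show False using z by blast
  qed
  have fin': "finite (conjugates M)" "finite (conjugates M')"
    using conj_sub[OF M(1)] conj_sub[OF M'(1)] fin by (meson finite_Diff finite_subset)+
  have "card (conjugates M) + card (conjugates M') = card (conjugates M \<union> conjugates M')"
    using fin' disj by (simp add: card_Un_disjoint)
  also have "\<dots> \<le> card (carrier G - {\<one>})"
    using conj_sub[OF M(1)] conj_sub[OF M'(1)] fin by (intro card_mono) auto
  also have "\<dots> = order G - 1" by (simp add: order_def)
  finally show False using c c' by linarith
qed

end

text \<open>An orbit that is not a fixed point has size a positive power of \<open>p\<close>. If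
  \<open>e\<close> were the only fixed point, \<open>card E\<close> would be congruent to 1 modulo
  \<open>p\<close>.\<close>

lemma (in group_action) p_group_second_fixed_point:
  assumes p: "prime p" "order G = p ^ a" and E: "finite E" "p dvd card E"
    and e: "e \<in> E" "\<And>g. g \<in> carrier G \<Longrightarrow> \<phi> g e = e"
  obtains f where "f \<in> E" "f \<noteq> e" "\<And>g. g \<in> carrier G \<Longrightarrow> \<phi> g f = f"
proof (rule ccontr)
  assume "\<not> thesis"
  with that have only_e: "\<And>f. f \<in> E \<Longrightarrow> (\<And>g. g \<in> carrier G \<Longrightarrow> \<phi> g f = f) \<Longrightarrow> f = e" by blast
  have orb_e: "orbit G \<phi> e = {e}"
    using e(2) orbit_refl[OF e(1)] by (auto simp: orbit_def)
  have dvd: "p dvd card X" if X: "X \<in> orbits G E \<phi> - {orbit G \<phi> e}" for X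
  proof -
    obtain x where x: "x \<in> E" "X = orbit G \<phi> x" using X by (auto simp: orbits_def)
    have "card X dvd p ^ a" using orbit_stabilizer_theorem[OF x(1)] x(2) p(2) by (metis dvd_triv_left)
    then obtain i where i: "card X = p ^ i" using p(1) by (auto simp: divides_primepow_nat)
    have "i \<noteq> 0"
    proof
      assume "i = 0"
      then obtain y where "X = {y}" using i by (auto simp: card_1_singleton_iff)
      then have "X = {x}" using orbit_refl[OF x(1)] x(2) by auto
      then have "\<phi> g x = x" if "g \<in> carrier G" for g using that x(2) by (auto simp: orbit_def)
      then have "x = e" using only_e x(1) by blast
      then show False using X x by blast
    qed
    then show ?thesis using i by simp
  qed
  have fin: "finite (orbits G E \<phi>)"
    using E(1) by (auto simp: orbits_def)
  have "card E = (\<Sum>X\<in>orbits G E \<phi>. card X)"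
    using disjoint_sum[OF E(1), of "\<lambda>_. 1 :: nat"] by simp
  also have "\<dots> = 1 + (\<Sum>X\<in>orbits G E \<phi> - {orbit G \<phi> e}. card X)"
    using fin e(1) orb_e by (subst sum.remove[of _ "orbit G \<phi> e"]) (auto simp: orbits_def)
  finally have "p dvd 1 + (\<Sum>X\<in>orbits G E \<phi> - {orbit G \<phi> e}. card X)" using E(2) by simp
  moreover have "p dvd (\<Sum>X\<in>orbits G E \<phi> - {orbit G \<phi> e}. card X)"
    using dvd by (rule dvd_sum)
  ultimately have "p dvd 1" by (metis dvd_add_left_iff)
  then show False using p(1) by simp
qed

section \<open>Centralizers and Sylow subgroups\<close>

context group
begin

text \<open>The maps are restricted to \<open>A\<close> because \<open>BijGroup\<close> consists of
  extensional bijections.\<close>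

lemma conjugation_action_on_normal:
  assumes P: "subgroup P G" and A: "A \<lhd> G"
  shows "group_action (G\<lparr>carrier := P\<rparr>) A (\<lambda>g. \<lambda>a\<in>A. conjugate g a)"
proof -
  interpret P: subgroup P G by (rule P)
  interpret A: normal A G by (rule A)
  have closed: "conjugate g a \<in> A" if "g \<in> carrier G" "a \<in> A" for g a
    using that A.inv_op_closed2 by (simp add: conjugate_def)
  have bij: "(\<lambda>a\<in>A. conjugate g a) \<in> Bij A" if "g \<in> carrier G" for g
  proof -
    have "bij_betw (\<lambda>a\<in>A. conjugate g a) A A"
      using that closed
      by (intro bij_betw_byWitness[of _ "\<lambda>a. conjugate (inv g) a"]) auto
    then show ?thesis by (simp add: Bij_def)
  qed
  have "group (G\<lparr>carrier := P\<rparr>)" by (rule subgroup.subgroup_is_group[OF P is_group])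
  moreover have "(\<lambda>g. \<lambda>a\<in>A. conjugate g a) \<in> hom (G\<lparr>carrier := P\<rparr>) (BijGroup A)"
  proof (rule homI)
    fix g h assume gh: "g \<in> carrier (G\<lparr>carrier := P\<rparr>)" "h \<in> carrier (G\<lparr>carrier := P\<rparr>)"
    then have gh': "g \<in> carrier G" "h \<in> carrier G" by auto
    show "(\<lambda>a\<in>A. conjugate (g \<otimes>\<^bsub>G\<lparr>carrier := P\<rparr>\<^esub> h) a) =
        (\<lambda>a\<in>A. conjugate g a) \<otimes>\<^bsub>BijGroup A\<^esub> (\<lambda>a\<in>A. conjugate h a)"
      using bij[OF gh'(1)] bij[OF gh'(2)] gh' closed
      by (auto simp: BijGroup_def compose_def conjugate_mult intro!: restrict_ext)
  qed (use bij in \<open>auto simp: BijGroup_def\<close>)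
  ultimately show ?thesis
    unfolding group_action_def group_hom_def group_hom_axioms_def using group_BijGroup by blast
qed

definition centralizing :: "'a \<Rightarrow> 'a set" where
  "centralizing z = {x \<in> carrier G. x \<otimes> z = z \<otimes> x}"

lemma centralizing_subgroup:
  assumes "z \<in> carrier G" shows "subgroup (centralizing z) G"
proof -
  have eq: "centralizing z = {x \<in> carrier G. conjugate x z = z}"
    using assms by (auto simp: centralizing_def conjugate_eq_self_iff)
  show ?thesis
  proof (rule subgroupI)
    show "centralizing z \<noteq> {}" using assms by (auto simp: eq intro: exI[of _ \<one>])
    show "inv a \<in> centralizing z" if "a \<in> centralizing z" for a
      using that assms conjugate_inv(2)[of a z] by (auto simp: eq)
    show "a \<otimes> b \<in> centralizing z" if "a \<in> centralizing z" "b \<in> centralizing z" for a b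
      using that assms by (auto simp: eq conjugate_mult)
  qed (auto simp: eq)
qed

lemma card_dvd_card_subgroup:
  assumes "subgroup H G" "subgroup K G" "H \<subseteq> K"
  shows "card H dvd card K"
proof -
  interpret K: group "G\<lparr>carrier := K\<rparr>" by (rule subgroup.subgroup_is_group[OF assms(2) is_group])
  have "subgroup H (G\<lparr>carrier := K\<rparr>)" using assms by (simp add: subgroup_incl)
  then have "card H dvd order (G\<lparr>carrier := K\<rparr>)" using K.lagrange by (metis dvd_triv_right)
  then show ?thesis by (simp add: order_def)
qed

lemma sylow_subgroup_multiplicity:
  assumes "prime p" "finite (carrier G)"
  obtains P where "subgroup P G" "card P = p ^ multiplicity p (order G)"
proof -
  obtain m where "order G = p ^ multiplicity p (order G) * m"
    using multiplicity_dvd[of p "order G"] by blast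
  then show ?thesis using sylow_thm[OF assms(1) is_group _ assms(2)] that by blast
qed

text \<open>\<open>H\<close> contains a Sylow \<open>p\<close>-subgroup of \<open>G\<close>, so
  \<open>card H\<close> already uses up the full \<open>p\<close>-part of the order.\<close>

lemma not_dvd_index_if_sylow_subset:
  assumes p: "prime p" and fin: "finite (carrier G)"
    and H: "subgroup H G" "card P = p ^ multiplicity p (order G)" "subgroup P G" "P \<subseteq> H"
  shows "\<not> p dvd card (rcosets H)"
proof
  assume "p dvd card (rcosets H)"
  moreover have "card P dvd card H" using H by (intro card_dvd_card_subgroup)
  ultimately have "p * p ^ multiplicity p (order G) dvd card (rcosets H) * card H"
    using H(2) by (intro mult_dvd_mono) auto
  then have "p ^ Suc (multiplicity p (order G)) dvd order G" using lagrange[OF H(1)] by simp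
  moreover have "order G \<noteq> 0" using fin order_gt_0_iff_finite by simp
  ultimately show False using p multiplicity_geI[of "order G" p] not_prime_unit
    by (metis Suc_n_not_le_n)
qed

text \<open>Here \<open>p\<close> is a prime divisor of the order of \<open>z\<close> and
  \<open>k\<close> the cofactor.\<close>

lemma element_of_prime_order:
  assumes fin: "finite (carrier G)" and z: "z \<in> carrier G" "z \<noteq> \<one>"
  obtains p k :: nat where "prime p" "(z [^] k) [^] p = \<one>" "z [^] k \<noteq> \<one>"
proof -
  have "ord z \<noteq> 1" using z ord_eq_1 by blast
  then obtain p where p: "prime p" "p dvd ord z" using prime_factor_nat by blast
  then obtain k where k: "ord z = p * k" by blast
  have "ord z > 0" using ord_ge_1[OF fin z(1)] by simp
  have "(z [^] k) [^] p = \<one>" using z(1) k pow_ord_eq_1[OF z(1)] by (simp add: nat_pow_pow mult.commute)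
  moreover have "z [^] k \<noteq> \<one>"
  proof
    assume "z [^] k = \<one>"
    then have "p * k dvd k" using pow_eq_id[OF z(1)] k by simp
    then show False using \<open>ord z > 0\<close> k p(1) by (auto dest: dvd_imp_le simp: prime_gt_1_nat)
  qed
  ultimately show ?thesis using p by (intro that)
qed

text \<open>The centre of a proper normal subgroup supplies the abelian group \<open>A\<close>. A Sylow \<open>p\<close>-subgroup
  fixes a nontrivial element of \<open>A\<close>; as that element is not central, some Sylow \<open>q\<close>-subgroup
  with \<open>q \<noteq> p\<close> moves it.\<close>

lemma minimal_non_nilpotent_structure:
  assumes fin: "finite (carrier G)" and nn: "\<not> nilpotent_group G"
    and nil: "\<And>H. subgroup H G \<Longrightarrow> H \<noteq> carrier G \<Longrightarrow> nilpotent_group (G\<lparr>carrier := H\<rparr>)"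
    and centerless: "\<And>z. z \<in> carrier G \<Longrightarrow> (\<And>x. x \<in> carrier G \<Longrightarrow> x \<otimes> z = z \<otimes> x) \<Longrightarrow> z = \<one>"
  obtains p q :: nat and A b g where "prime p" "prime q" "p \<noteq> q" "A \<lhd> G"
    "\<And>x y. x \<in> A \<Longrightarrow> y \<in> A \<Longrightarrow> x \<otimes> y = y \<otimes> x" "\<And>x. x \<in> A \<Longrightarrow> x [^] p = \<one>"
    "g \<in> carrier G" "\<And>x. x \<in> A \<Longrightarrow> (g [^] q) \<otimes> x = x \<otimes> (g [^] q)"
    "b \<in> A" "g \<otimes> b \<noteq> b \<otimes> g"
proof -
  obtain N where N: "N \<lhd> G" "N \<noteq> {\<one>}" "N \<noteq> carrier G"
    using ex_proper_normal_subgroup[OF fin nn nil] by blast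
  interpret N: normal N G by (rule N)
  have Nsub: "subgroup N G" by (rule N.subgroup_axioms)
  interpret GN: group "G\<lparr>carrier := N\<rparr>" by (rule subgroup.subgroup_is_group[OF Nsub is_group])
  obtain z0 where z0: "z0 \<in> N" "z0 \<noteq> \<one>" "\<And>x. x \<in> N \<Longrightarrow> x \<otimes> z0 = z0 \<otimes> x"
    using GN.nilpotent_center_nontrivial[OF nil[OF Nsub N(3)]] N(2) by auto
  obtain p k :: nat where p: "prime p" "(z0 [^] k) [^] p = \<one>" "z0 [^] k \<noteq> \<one>"
    using element_of_prime_order[OF fin _ z0(2)] z0(1) N.mem_carrier by blast
  define z where "z = z0 [^] k"
  \<comment> \<open>The central elements of \<open>N\<close> killed by \<open>p\<close> form a
    characteristic subgroup of \<open>N\<close>, hence a normal subgroup of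
    \<open>G\<close>.\<close>
  define A where "A = {a \<in> N. (\<forall>x\<in>N. x \<otimes> a = a \<otimes> x) \<and> a [^] p = \<one>}"
  have A_eq: "A = {a \<in> N. (\<forall>x\<in>N. conjugate x a = a) \<and> a [^] p = \<one>}"
    unfolding A_def using conjugate_eq_self_iff[OF N.mem_carrier N.mem_carrier] by blast
  have AN: "A \<subseteq> N" by (auto simp: A_def)
  have Acomm: "x \<otimes> y = y \<otimes> x" if "x \<in> A" "y \<in> A" for x y
    using that unfolding A_def by blast
  have Apow: "x [^] p = \<one>" if "x \<in> A" for x using that by (auto simp: A_def)
  have Asub: "subgroup A G"
  proof (rule subgroupI)
    show "A \<subseteq> carrier G" using AN N.subset by blast
    have "\<one> \<in> A" by (simp add: A_def)
    then show "A \<noteq> {}" by blast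
    show "inv a \<in> A" if a: "a \<in> A" for a
    proof -
      have "conjugate x (inv a) = inv a" if "x \<in> N" for x
      proof -
        interpret c: group_hom G G "conjugate x" using that by (intro conjugate_hom) auto
        show ?thesis using a that by (auto simp: A_eq)
      qed
      then show ?thesis using a by (auto simp: A_eq nat_pow_inv)
    qed
    show "a \<otimes> b \<in> A" if ab: "a \<in> A" "b \<in> A" for a b
    proof -
      have "conjugate x (a \<otimes> b) = a \<otimes> b" if "x \<in> N" for x
      proof -
        interpret c: group_hom G G "conjugate x" using that by (intro conjugate_hom) auto
        show ?thesis using ab that by (auto simp: A_eq)
      qed
      moreover have "(a \<otimes> b) [^] p = \<one>"
        using pow_mult_distrib[OF Acomm[OF ab] N.mem_carrier N.mem_carrier, of p] ab AN Apow by auto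
      ultimately show ?thesis using ab by (auto simp: A_eq)
    qed
  qed
  have Anormal: "A \<lhd> G"
  proof (rule normalI_conjugate[OF Asub])
    fix x n assume x: "x \<in> carrier G" and n: "n \<in> A"
    interpret c: group_hom G G "conjugate x" using x by (intro conjugate_hom) auto
    have cN: "conjugate u y \<in> N" if "y \<in> N" "u \<in> carrier G" for y u
      using that N.inv_op_closed2 by (simp add: conjugate_def)
    have nG: "n \<in> carrier G" using n AN by auto
    have "conjugate y (conjugate x n) = conjugate x n" if y: "y \<in> N" for y
    proof -
      have "conjugate (conjugate (inv x) y) n = n"
        using n cN[OF y, of "inv x"] x by (auto simp: A_eq)
      then have "conjugate (inv x \<otimes> y \<otimes> x) n = n" using x by (simp add: conjugate_def[of "inv x"])
      then have "conjugate (inv x) (conjugate y (conjugate x n)) = n"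
        using x y nG by (simp add: conjugate_mult)
      then show ?thesis using x y nG by (metis N.mem_carrier conjugate_closed conjugate_inv(1))
    qed
    moreover have "conjugate x n [^] p = \<one>"
      using c.hom_nat_pow[OF nG, of p] Apow[OF n] by simp
    ultimately show "conjugate x n \<in> A" using cN n x AN by (auto simp: A_eq)
  qed
  interpret A: normal A G by (rule Anormal)
  have zN: "z0 [^] (j::nat) \<in> N \<and> (\<forall>x\<in>N. x \<otimes> z0 [^] j = z0 [^] j \<otimes> x)" for j
  proof (induction j)
    case (Suc j)
    have "x \<otimes> (z0 [^] j \<otimes> z0) = (z0 [^] j \<otimes> z0) \<otimes> x" if x: "x \<in> N" for x
    proof -
      have mem: "x \<in> carrier G" "z0 \<in> carrier G" "z0 [^] j \<in> carrier G" using x z0(1) by auto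
      have "x \<otimes> (z0 [^] j \<otimes> z0) = (x \<otimes> z0 [^] j) \<otimes> z0" using mem by (simp add: m_assoc)
      also have "\<dots> = z0 [^] j \<otimes> (x \<otimes> z0)" using Suc x mem by (simp add: m_assoc)
      also have "\<dots> = (z0 [^] j \<otimes> z0) \<otimes> x" using z0(3)[OF x] mem by (simp add: m_assoc)
      finally show ?thesis .
    qed
    then show ?case using Suc z0(1) by simp
  qed auto
  have zA: "z \<in> A" "z \<noteq> \<one>" using zN[of k] p by (auto simp: A_def z_def)
  have "p dvd card A"
  proof -
    have "subgroup (generate G {z}) G" using zA by (intro generate_is_subgroup) auto
    moreover have "generate G {z} \<subseteq> A" using zA Asub by (intro generate_subgroup_incl) auto
    ultimately have "card (generate G {z}) dvd card A" using Asub by (intro card_dvd_card_subgroup)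
    moreover have "ord z = p"
    proof -
      have "ord z dvd p" using pow_eq_id[of z p] Apow zA by auto
      moreover have "ord z \<noteq> 1" using zA ord_eq_1 by auto
      ultimately show ?thesis using p(1) by (auto simp: prime_nat_iff)
    qed
    ultimately show ?thesis using generate_pow_card[of z] zA by auto
  qed
  obtain P where P: "subgroup P G" "card P = p ^ multiplicity p (order G)"
    using sylow_subgroup_multiplicity[OF p(1) fin] by blast
  interpret P: subgroup P G by (rule P)
  interpret act: group_action "G\<lparr>carrier := P\<rparr>" A "\<lambda>g. \<lambda>a\<in>A. conjugate g a"
    by (rule conjugation_action_on_normal[OF P(1) Anormal])
  \<comment> \<open>\<open>P\<close> acts on \<open>A\<close> by conjugation and fixes
    \<open>\<one>\<close>; as \<open>p\<close> divides \<open>card A\<close>, it fixes a further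
    element.\<close>
  obtain f where f: "f \<in> A" "f \<noteq> \<one>" "\<And>g. g \<in> P \<Longrightarrow> conjugate g f = f"
  proof (rule act.p_group_second_fixed_point[OF p(1), of "multiplicity p (order G)" \<one>])
    show "order (G\<lparr>carrier := P\<rparr>) = p ^ multiplicity p (order G)" using P(2) by (simp add: order_def)
    show "finite A" using fin A.subset by (rule rev_finite_subset)
  qed (use \<open>p dvd card A\<close> in auto)
  have fG: "f \<in> carrier G" using f by auto
  have PC: "P \<subseteq> centralizing f" using f fG by (auto simp: centralizing_def conjugate_eq_self_iff)
  note C = centralizing_subgroup[OF fG]
  \<comment> \<open>As \<open>f\<close> is not central, some prime \<open>q\<close> divides the
    index of its centralizer. It differs from \<open>p\<close> since the centralizer contains
    \<open>P\<close>, and no Sylow \<open>q\<close>-subgroup fits into the centralizer.\<close>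
  have "card (rcosets (centralizing f)) \<noteq> 1"
  proof
    assume "card (rcosets (centralizing f)) = 1"
    then have "card (centralizing f) = card (carrier G)" using lagrange[OF C] by (simp add: order_def)
    then have "centralizing f = carrier G" using fin subgroup.subset[OF C] by (intro card_subset_eq)
    then have "f = \<one>" using centerless[OF fG] by (auto simp: centralizing_def)
    then show False using f by blast
  qed
  then obtain q where q: "prime q" "q dvd card (rcosets (centralizing f))"
    using prime_factor_nat by blast
  have "p \<noteq> q" using not_dvd_index_if_sylow_subset[OF p(1) fin C P(2,1) PC] q by blast
  obtain Q where Q: "subgroup Q G" "card Q = q ^ multiplicity q (order G)"
    using sylow_subgroup_multiplicity[OF q(1) fin] by blast
  have "\<not> Q \<subseteq> centralizing f"
    using not_dvd_index_if_sylow_subset[OF q(1) fin C Q(2,1)] q by blast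
  then obtain h where h: "h \<in> Q" "h \<notin> centralizing f" by blast
  have hG: "h \<in> carrier G" using h subgroup.subset[OF Q(1)] by blast
  interpret GQ: group "G\<lparr>carrier := Q\<rparr>" by (rule subgroup.subgroup_is_group[OF Q(1) is_group])
  have "h [^] card Q = \<one>"
    using GQ.pow_order_eq_1[of h] h by (simp add: order_def nat_pow_consistent[symmetric])
  \<comment> \<open>The order of \<open>h\<close> is a power of \<open>q\<close>. With
    \<open>j\<close> least such that \<open>h [^] (q ^ j)\<close> centralizes \<open>A\<close>, the
    element \<open>g = h [^] (q ^ (j - 1))\<close> induces an automorphism of order exactly
    \<open>q\<close>.\<close>
  then have "\<exists>j. \<forall>x\<in>A. h [^] (q ^ j) \<otimes> x = x \<otimes> h [^] (q ^ j)"
    using Q(2) by (intro exI[of _ "multiplicity q (order G)"]) auto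
  then obtain j where j: "\<forall>x\<in>A. h [^] (q ^ j) \<otimes> x = x \<otimes> h [^] (q ^ j)"
    "\<And>i. i < j \<Longrightarrow> \<not> (\<forall>x\<in>A. h [^] (q ^ i) \<otimes> x = x \<otimes> h [^] (q ^ i))"
    using exists_least_iff[of "\<lambda>j. \<forall>x\<in>A. h [^] (q ^ j) \<otimes> x = x \<otimes> h [^] (q ^ j)"] by blast
  have "j \<noteq> 0"
  proof
    assume "j = 0"
    then show False using j(1) f(1) h hG by (auto simp: centralizing_def)
  qed
  then obtain i where i: "j = Suc i" by (cases j) auto
  define g where "g = h [^] (q ^ i)"
  have g: "g \<in> carrier G" using hG by (simp add: g_def)
  have gq: "g [^] q = h [^] (q ^ j)" using hG i by (simp add: g_def nat_pow_pow mult.commute)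
  obtain b where "b \<in> A" "g \<otimes> b \<noteq> b \<otimes> g" using j(2)[of i] i by (auto simp: g_def)
  then show ?thesis
    using that[OF p(1) q(1) \<open>p \<noteq> q\<close> Anormal Acomm Apow g] j(1) gq by auto
qed

end

text \<open>A non-nilpotent group of minimal order among those satisfying the laws of \<open>G\<close> has nilpotent
  proper subgroups and trivial centre.\<close>

lemma non_nilpotent_structure:
  fixes G :: "('a, 'm) monoid_scheme"
  assumes G: "group G" "finite (carrier G)" "\<not> nilpotent_group G"
  obtains K :: "'a monoid" and p q :: nat and A b g where "group K"
    "\<And>w w'. law G w w' \<Longrightarrow> law K w w'"
    "prime p" "prime q" "p \<noteq> q" "A \<lhd> K"
    "\<And>x y. x \<in> A \<Longrightarrow> y \<in> A \<Longrightarrow> x \<otimes>\<^bsub>K\<^esub> y = y \<otimes>\<^bsub>K\<^esub> x" "\<And>x. x \<in> A \<Longrightarrow> x [^]\<^bsub>K\<^esub> p = \<one>\<^bsub>K\<^esub>"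
    "g \<in> carrier K" "\<And>x. x \<in> A \<Longrightarrow> (g [^]\<^bsub>K\<^esub> q) \<otimes>\<^bsub>K\<^esub> x = x \<otimes>\<^bsub>K\<^esub> (g [^]\<^bsub>K\<^esub> q)"
    "b \<in> A" "g \<otimes>\<^bsub>K\<^esub> b \<noteq> b \<otimes>\<^bsub>K\<^esub> g"
proof -
  define good where "good = (\<lambda>K :: 'a monoid. group K \<and> finite (carrier K) \<and> \<not> nilpotent_group K \<and>
    (\<forall>w w'. law G w w' \<longrightarrow> law K w w'))"
  interpret G: group G by (rule G)
  have "\<exists>K. good K"
  proof -
    \<comment> \<open>Factoring out the trivial subgroup merely turns \<open>G\<close> into a group
      of type \<open>'a monoid\<close>, without its additional record fields.\<close>
    have triv: "{\<one>\<^bsub>G\<^esub>} \<lhd> G" 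
      by (rule G.normalI_conjugate) (auto simp: G.triv_subgroup)
    obtain f :: "'a \<Rightarrow> 'a" where f: "weak_group_morphism f {\<one>\<^bsub>G\<^esub>} G"
      using G.exists_weak_group_morphism[OF triv] by blast
    interpret h: group_hom G "image_group f G" f by (rule G.weak_group_morphism_group_hom[OF f])
    have "\<not> nilpotent_group (image_group f G)"
      using G.nilpotent_if_mod_central_nilpotent[OF f] G(3) by auto
    moreover have "law (image_group f G) w w'" if "law G w w'" for w w'
      using h.law_hom_image that by (simp add: image_group_carrier)
    ultimately have "good (image_group f G)"
      using G(2) h.H.group_axioms by (auto simp: good_def image_group_carrier)
    then show ?thesis by blast
  qed
  then obtain K where K: "good K" and min: "\<And>K'. good K' \<Longrightarrow> order K \<le> order K'"
    using exists_least_iff[of "\<lambda>n. \<exists>K. good K \<and> order K = n"] by (metis not_le)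
  interpret K: group K using K by (simp add: good_def)
  have fin: "finite (carrier K)" and nn: "\<not> nilpotent_group K"
    and law: "\<And>w w'. law G w w' \<Longrightarrow> law K w w'" using K by (auto simp: good_def)
  have nil: "nilpotent_group (K\<lparr>carrier := H\<rparr>)" if H: "subgroup H K" "H \<noteq> carrier K" for H
  proof (rule ccontr)
    assume "\<not> nilpotent_group (K\<lparr>carrier := H\<rparr>)"
    moreover have "group (K\<lparr>carrier := H\<rparr>)" by (rule subgroup.subgroup_is_group[OF H(1) K.is_group])
    moreover have "H \<subset> carrier K" using H subgroup.subset by blast
    moreover from this have "finite H" using fin finite_subset by blast
    ultimately have "good (K\<lparr>carrier := H\<rparr>)" using law law_subgroup[OF H(1)] by (auto simp: good_def)
    then have "order K \<le> card H" using min by (force simp: order_def)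
    moreover have "card H < order K"
      unfolding order_def using \<open>H \<subset> carrier K\<close> fin by (rule psubset_card_mono[rotated])
    ultimately show False by linarith
  qed
  have centerless: "z = \<one>\<^bsub>K\<^esub>"
    if z: "z \<in> carrier K" "\<And>x. x \<in> carrier K \<Longrightarrow> x \<otimes>\<^bsub>K\<^esub> z = z \<otimes>\<^bsub>K\<^esub> x" for z
  proof (rule ccontr)
    assume "z \<noteq> \<one>\<^bsub>K\<^esub>"
    define Z where "Z = {z \<in> carrier K. \<forall>x\<in>carrier K. x \<otimes>\<^bsub>K\<^esub> z = z \<otimes>\<^bsub>K\<^esub> x}"
    have Z_eq: "Z = {z \<in> carrier K. \<forall>x\<in>carrier K. K.conjugate x z = z}"
      by (auto simp: Z_def K.conjugate_eq_self_iff)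
    have "subgroup Z K"
    proof (rule K.subgroupI)
      show "inv\<^bsub>K\<^esub> a \<in> Z" if a: "a \<in> Z" for a
      proof -
        have "K.conjugate x (inv\<^bsub>K\<^esub> a) = inv\<^bsub>K\<^esub> a" if "x \<in> carrier K" for x
        proof -
          interpret c: group_hom K K "K.conjugate x" using that by (rule K.conjugate_hom)
          show ?thesis using a that by (auto simp: Z_eq)
        qed
        then show ?thesis using a by (auto simp: Z_eq)
      qed
      show "a \<otimes>\<^bsub>K\<^esub> b \<in> Z" if ab: "a \<in> Z" "b \<in> Z" for a b
      proof -
        have "K.conjugate x (a \<otimes>\<^bsub>K\<^esub> b) = a \<otimes>\<^bsub>K\<^esub> b" if "x \<in> carrier K" for x
        proof -
          interpret c: group_hom K K "K.conjugate x" using that by (rule K.conjugate_hom)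
          show ?thesis using ab that by (auto simp: Z_eq)
        qed
        then show ?thesis using ab by (auto simp: Z_eq)
      qed
    qed (auto simp: Z_def intro: exI[of _ "\<one>\<^bsub>K\<^esub>"])
    then have Z: "Z \<lhd> K" by (rule K.normalI_conjugate) (auto simp: Z_eq)
    then obtain f :: "'a \<Rightarrow> 'a" where f: "weak_group_morphism f Z K"
      using K.exists_weak_group_morphism by blast
    interpret h: group_hom K "image_group f K" f by (rule K.weak_group_morphism_group_hom[OF f])
    have "\<not> nilpotent_group (image_group f K)"
      using K.nilpotent_if_mod_central_nilpotent[OF f] nn by (auto simp: Z_def)
    moreover have "law (image_group f K) w w'" if "law G w w'" for w w'
      using h.law_hom_image law[OF that] by (simp add: image_group_carrier)
    ultimately have "good (image_group f K)"
      using fin h.H.group_axioms by (auto simp: good_def image_group_carrier)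
    \<comment> \<open>Minimality of \<open>K\<close> forces the quotient map by the centre to be
      injective, although it identifies \<open>z\<close> with \<open>\<one>\<close>.\<close>
    then have "card (carrier K) \<le> card (f ` carrier K)"
      using min by (force simp: order_def image_group_carrier)
    then have "inj_on f (carrier K)"
      using fin card_image_le[OF fin, of f] by (intro eq_card_imp_inj_on) auto
    moreover have "f z = f \<one>\<^bsub>K\<^esub>"
      using weak_group_morphism.inj_mod_subgroup[OF f z(1) K.one_closed] z by (simp add: Z_def)
    ultimately show False using \<open>z \<noteq> \<one>\<^bsub>K\<^esub>\<close> inj_onD[OF _ _ z(1) K.one_closed] by blast
  qed
  show ?thesis
  proof (rule K.minimal_non_nilpotent_structure[OF fin nn])
    show "nilpotent_group (K\<lparr>carrier := H\<rparr>)" if "subgroup H K" "H \<noteq> carrier K" for H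
      using that by (rule nil)
    show "z = \<one>\<^bsub>K\<^esub>" if "z \<in> carrier K" "\<And>x. x \<in> carrier K \<Longrightarrow> x \<otimes>\<^bsub>K\<^esub> z = z \<otimes>\<^bsub>K\<^esub> x" for z
      using that by (rule centerless)
  qed (rule that[OF K.is_group law]; blast)
qed

section \<open>Counting letters by characters\<close>

text \<open>The letter \<open>0\<close> stands for \<open>v\<close>, the letter \<open>i \<ge> 1\<close> for \<open>x\<^sub>i\<close>. The letters of a word act from right
  to left, so a suffix determines the translate at which the letter before it acts.\<close>

primrec marks :: "nat list \<Rightarrow> (nat \<Rightarrow> nat) list" where
  "marks [] = []"
| "marks (l # w) = (if l = 0 then [count_list w] else []) @ marks w"

text \<open>The number of occurrences of \<open>v\<close> that act over the origin modulo
  \<open>q\<close> when the word is applied at the translate \<open>d\<close>. Other fibres are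
  reached by changing \<open>d\<close>.\<close>

definition hits :: "nat \<Rightarrow> nat \<Rightarrow> (nat \<Rightarrow> nat) \<Rightarrow> nat list \<Rightarrow> nat" where
  "hits q n d w = length (filter (\<lambda>c. \<forall>i\<in>{1..n}. q dvd d i + c i) (marks w))"

text \<open>The structure found above: conjugation by \<open>g\<close> induces an automorphism of
  prime order \<open>q\<close> on the elementary abelian \<open>p\<close>-group \<open>A\<close>,
  and it moves \<open>b\<close>.\<close>

locale coprime_conjugation = group G for G (structure) +
  fixes p q :: nat and A b g
  assumes p: "prime p" and q: "prime q" and pq: "p \<noteq> q"
    and A: "A \<lhd> G"
    and A_comm: "\<And>x y. x \<in> A \<Longrightarrow> y \<in> A \<Longrightarrow> x \<otimes> y = y \<otimes> x"
    and A_pow: "\<And>x. x \<in> A \<Longrightarrow> x [^] p = \<one>"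
    and g: "g \<in> carrier G"
    and gq: "\<And>x. x \<in> A \<Longrightarrow> (g [^] q) \<otimes> x = x \<otimes> (g [^] q)"
    and b: "b \<in> A" and gb: "g \<otimes> b \<noteq> b \<otimes> g"
begin

sublocale A: normal A G by (rule A)

lemma comm_group_A: "comm_group (G\<lparr>carrier := A\<rparr>)"
proof -
  interpret H: group "G\<lparr>carrier := A\<rparr>" by (rule A.subgroup_is_group) (rule is_group)
  show ?thesis by unfold_locales (simp add: A_comm)
qed

sublocale A: comm_group "G\<lparr>carrier := A\<rparr>" by (rule comm_group_A)

text \<open>Finite products need commutativity and are therefore formed in \<open>A\<close> instead
  of the whole group.\<close>

abbreviation prodA :: "('i \<Rightarrow> 'a) \<Rightarrow> 'i set \<Rightarrow> 'a" where
  "prodA \<equiv> finprod (G\<lparr>carrier := A\<rparr>)"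

text \<open>Otherwise a Bezout combination of \<open>q\<close> and \<open>k\<close> shows that
  \<open>g\<close> itself centralizes \<open>b\<close>.\<close>

lemma q_dvd_if_centralizes:
  fixes k :: int
  assumes "g [^] k \<in> centralizing b"
  shows "int q dvd k"
proof (rule ccontr)
  assume "\<not> int q dvd k"
  have bG: "b \<in> carrier G" using b by auto
  note C = centralizing_subgroup[OF bG]
  have "coprime (int q) k" using \<open>\<not> int q dvd k\<close> q by (simp add: prime_imp_coprime)
  then obtain u v where uv: "u * int q + v * k = 1" using bezout_int[of "int q" k] by auto
  have "g [^] int q \<in> centralizing b"
    using gq[OF b] g by (simp add: centralizing_def int_pow_int)
  then have "(g [^] int q) [^] u \<otimes> (g [^] k) [^] v \<in> centralizing b"
    using assms subgroup_int_pow_closed[OF C] subgroup.m_closed[OF C] by blast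
  moreover have "(g [^] int q) [^] u \<otimes> (g [^] k) [^] v = g [^] (1::int)"
    using g uv by (simp add: int_pow_pow int_pow_mult[symmetric] mult.commute)
  ultimately show False using gb g by (simp add: centralizing_def)
qed

text \<open>The direction of conjugation is chosen so that
  \<open>x \<otimes> g [^] k = g [^] k \<otimes> \<tau> k x\<close>: it records what becomes of
  \<open>x\<close> when powers of \<open>g\<close> are collected on the left.\<close>

definition \<tau> :: "nat \<Rightarrow> 'a \<Rightarrow> 'a" where
  "\<tau> k = conjugate (inv (g [^] k))"

lemma \<tau>_mem [simp]: "x \<in> A \<Longrightarrow> \<tau> k x \<in> A"
  using A.inv_op_closed1 g by (simp add: \<tau>_def conjugate_def)

lemma \<tau>_mem_carrier [simp]: "x \<in> A \<Longrightarrow> \<tau> k x \<in> carrier G"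
  by (rule A.mem_carrier) simp

lemma \<tau>_add: "x \<in> A \<Longrightarrow> \<tau> (k + m) x = \<tau> k (\<tau> m x)"
proof -
  assume "x \<in> A"
  have "g [^] (k + m) = g [^] m \<otimes> g [^] k" using g by (simp add: nat_pow_mult add.commute)
  then show ?thesis using \<open>x \<in> A\<close> g by (simp add: \<tau>_def inv_mult_group conjugate_mult)
qed

lemma \<tau>_0 [simp]: "x \<in> A \<Longrightarrow> \<tau> 0 x = x"
  by (simp add: \<tau>_def)

lemma \<tau>_q [simp]: "x \<in> A \<Longrightarrow> \<tau> q x = x"
proof -
  assume "x \<in> A"
  then have "conjugate (g [^] q) x = x" using gq g by (simp add: conjugate_eq_self_iff)
  then show ?thesis using conjugate_inv(2)[of "g [^] q" x] g \<open>x \<in> A\<close> by (simp add: \<tau>_def)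
qed

lemma \<tau>_mult_q [simp]: "x \<in> A \<Longrightarrow> \<tau> (q * m) x = x"
  by (induction m) (simp_all add: \<tau>_add)

lemma \<tau>_mod: "x \<in> A \<Longrightarrow> \<tau> (k mod q) x = \<tau> k x"
  using \<tau>_add[of x "k mod q" "q * (k div q)"] by simp

lemma \<tau>_dvd: "x \<in> A \<Longrightarrow> q dvd k \<Longrightarrow> \<tau> k x = x"
  by (auto elim!: dvdE)

lemma \<tau>_mult: "x \<in> A \<Longrightarrow> y \<in> A \<Longrightarrow> \<tau> k (x \<otimes> y) = \<tau> k x \<otimes> \<tau> k y"
proof -
  interpret c: group_hom G G "\<tau> k" unfolding \<tau>_def by (rule conjugate_hom) (use g in simp)
  show "x \<in> A \<Longrightarrow> y \<in> A \<Longrightarrow> \<tau> k (x \<otimes> y) = \<tau> k x \<otimes> \<tau> k y" by simp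
qed

lemma \<tau>_inv: "x \<in> A \<Longrightarrow> \<tau> k (inv x) = inv (\<tau> k x)"
proof -
  interpret c: group_hom G G "\<tau> k" unfolding \<tau>_def by (rule conjugate_hom) (use g in simp)
  show "x \<in> A \<Longrightarrow> \<tau> k (inv x) = inv (\<tau> k x)" by simp
qed

text \<open>A commutator, chosen so that its norm \<open>\<Prod>s<q. \<tau> s a\<close> telescopes to \<open>\<one>\<close>.\<close>

definition a where "a = \<tau> 1 b \<otimes> inv b"

lemma a_mem [simp]: "a \<in> A"
  using b by (simp add: a_def)

lemma a_carrier [simp]: "a \<in> carrier G"
  by (rule A.mem_carrier) simp

lemma a_neq_one: "a \<noteq> \<one>"
proof
  assume "a = \<one>"
  then have "\<tau> 1 b = b" using b by (metis A.mem_carrier \<tau>_mem a_def inv_solve_right l_one one_closed)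
  then have "conjugate (inv g) b = b" using g by (simp add: \<tau>_def)
  then have "conjugate g b = b" using conjugate_inv(1)[of g b] g b by auto
  then show False using gb conjugate_eq_self_iff[of g b] g b by auto
qed

lemma ord_a: "ord a = p"
proof -
  have "ord a dvd p" using pow_eq_id[of a p] A_pow by auto
  moreover have "ord a \<noteq> 1" using a_neq_one ord_eq_1 by auto
  ultimately show ?thesis using p by (auto simp: prime_nat_iff)
qed

lemma norm_a: "prodA (\<lambda>s. \<tau> s a) {..<q} = \<one>"
proof -
  \<comment> \<open>The product telescopes; at \<open>m = q\<close> the two factors cancel because
    \<open>\<tau> q\<close> is the identity on \<open>A\<close>.\<close>
  have "prodA (\<lambda>s. \<tau> s a) {..<m} = \<tau> m b \<otimes> inv b" for m
  proof (induction m)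
    case (Suc m)
    have mem: "\<tau> m b \<in> A" "\<tau> (Suc m) b \<in> A" "inv b \<in> A" using b by auto
    have "prodA (\<lambda>s. \<tau> s a) {..<Suc m} = \<tau> m a \<otimes> (\<tau> m b \<otimes> inv b)"
      using Suc by (simp add: lessThan_Suc Pi_def)
    also have "\<tau> m a = \<tau> (Suc m) b \<otimes> inv (\<tau> m b)"
      using b \<tau>_add[of b m 1] by (simp add: a_def \<tau>_mult \<tau>_inv)
    also have "\<dots> \<otimes> (\<tau> m b \<otimes> inv b) = \<tau> (Suc m) b \<otimes> inv b"
      using mem b by (simp add: m_assoc) (simp add: m_assoc[symmetric])
    finally show ?case .
  qed (use b in simp)
  then show ?thesis using b by simp
qed

text \<open>Since \<open>q\<close> is prime, sending \<open>s\<close> to \<open>k * s + r\<close>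
  permutes the residues modulo \<open>q\<close>, and the product is a reordered norm.\<close>

lemma twisted_norm_a:
  assumes "\<not> q dvd k"
  shows "prodA (\<lambda>s. \<tau> (k * s + r) a) {..<q} = \<one>"
proof -
  let ?h = "\<lambda>s. (k * s + r) mod q"
  have "coprime k q" using assms q by (metis coprime_commute prime_imp_coprime)
  have inj: "inj_on ?h {..<q}"
  proof (rule inj_onI)
    fix s t assume st: "s \<in> {..<q}" "t \<in> {..<q}" "?h s = ?h t"
    then have "[k * s + r = k * t + r] (mod q)" by (simp add: cong_def)
    then have "[s = t] (mod q)" using \<open>coprime k q\<close> by (simp add: cong_add_rcancel_nat cong_mult_lcancel_nat)
    then show "s = t" using st by (simp add: cong_less_modulus_unique_nat)
  qed
  have "?h ` {..<q} = {..<q}"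
    using inj q by (intro card_subset_eq) (auto simp: card_image prime_gt_0_nat)
  then have "prodA (\<lambda>s. \<tau> s a) {..<q} = prodA (\<lambda>s. \<tau> s a) (?h ` {..<q})" by simp
  also have "\<dots> = prodA (\<lambda>s. \<tau> (?h s) a) {..<q}" using inj by (intro A.finprod_reindex) auto
  also have "\<dots> = prodA (\<lambda>s. \<tau> (k * s + r) a) {..<q}" by (simp add: \<tau>_mod)
  finally show ?thesis using norm_a by simp
qed

text \<open>A vector \<open>\<chi>\<close> represents a character of the translation group
  \<open>(\<int>/q)\<^sup>n\<close>: the generator \<open>x\<^sub>i\<close> is evaluated at
  \<open>g [^] \<chi> i\<close>.\<close>

abbreviation characters :: "nat \<Rightarrow> (nat \<Rightarrow> nat) set" where
  "characters n \<equiv> {1..n} \<rightarrow>\<^sub>E {..<q}"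

definition pairing :: "nat \<Rightarrow> (nat \<Rightarrow> nat) \<Rightarrow> (nat \<Rightarrow> nat) \<Rightarrow> nat" where
  "pairing n \<chi> e = (\<Sum>i\<in>{1..n}. \<chi> i * e i)"

lemma pairing_add: "pairing n \<chi> (\<lambda>i. d i + e i) = pairing n \<chi> d + pairing n \<chi> e"
  by (simp add: pairing_def sum.distrib distrib_left)

text \<open>Orthogonality of characters, with the norm of \<open>a\<close> in the role of the
  vanishing sum of roots of unity.\<close>

lemma character_sum:
  "prodA (\<lambda>\<chi>. \<tau> (pairing n \<chi> e) a) (characters n) =
     (if \<forall>i\<in>{1..n}. q dvd e i then a [^] (q ^ n) else \<one>)"
proof (cases "\<forall>i\<in>{1..n}. q dvd e i")
  case True
  then have "q dvd pairing n \<chi> e" for \<chi>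
    unfolding pairing_def by (intro dvd_sum) auto
  then have "prodA (\<lambda>\<chi>. \<tau> (pairing n \<chi> e) a) (characters n) = prodA (\<lambda>\<chi>. a) (characters n)"
    by (simp add: \<tau>_dvd)
  also have "\<dots> = a [^]\<^bsub>G\<lparr>carrier := A\<rparr>\<^esub> card (characters n)" by (rule A.finprod_const) simp
  also have "card (characters n) = q ^ n" by (simp add: card_PiE)
  finally show ?thesis using True by (simp add: nat_pow_consistent[symmetric])
next
  case False
  then obtain j where j: "j \<in> {1..n}" "\<not> q dvd e j" by blast
  \<comment> \<open>The vectors are grouped by their coordinates other than \<open>j\<close>; on
    each group the remaining coordinate runs through a twisted norm.\<close>
  let ?I = "({1..n} - {j}) \<rightarrow>\<^sub>E {..<q}"
  let ?B = "\<lambda>\<chi>. (\<lambda>s. \<chi>(j := s)) ` {..<q}"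
  have ins: "{1..n} = insert j ({1..n} - {j})" using j by blast
  have UN: "characters n = (\<Union>\<chi>\<in>?I. ?B \<chi>)"
    by (subst ins, subst PiE_insert_eq) auto
  have disj: "pairwise (\<lambda>\<chi> \<psi>. disjnt (?B \<chi>) (?B \<psi>)) ?I"
  proof (rule pairwiseI)
    fix \<chi> \<psi> assume *: "\<chi> \<in> ?I" "\<psi> \<in> ?I" "\<chi> \<noteq> \<psi>"
    show "disjnt (?B \<chi>) (?B \<psi>)"
    proof (rule ccontr)
      assume "\<not> disjnt (?B \<chi>) (?B \<psi>)"
      then obtain s t where "\<chi>(j := s) = \<psi>(j := t)" by (auto simp: disjnt_def)
      moreover have "\<chi> j = \<psi> j" using * by (auto simp: PiE_def extensional_def)
      ultimately have "\<chi> = \<psi>" by (metis fun_upd_triv fun_upd_upd)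
      then show False using * by blast
    qed
  qed
  have inner: "prodA (\<lambda>\<chi>. \<tau> (pairing n \<chi> e) a) (?B \<chi>) = \<one>" for \<chi>
  proof -
    have "pairing n (\<chi>(j := s)) e = e j * s + (\<Sum>i\<in>{1..n} - {j}. \<chi> i * e i)" for s
      unfolding pairing_def using j(1) by (subst sum.remove[of _ j]) (auto simp: mult.commute intro!: sum.cong)
    moreover have "inj_on (\<lambda>s. \<chi>(j := s)) {..<q}" by (rule inj_onI) (metis fun_upd_same)
    ultimately show ?thesis
      using twisted_norm_a[OF j(2)] by (subst A.finprod_reindex) auto
  qed
  have "prodA (\<lambda>\<chi>. \<tau> (pairing n \<chi> e) a) (characters n)
      = prodA (\<lambda>\<chi>. prodA (\<lambda>\<chi>. \<tau> (pairing n \<chi> e) a) (?B \<chi>)) ?I"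
    unfolding UN by (rule A.finprod_UN_disjoint) (use disj in \<open>auto intro: finite_PiE\<close>)
  also have "\<dots> = \<one>" using inner A.finprod_one_eqI[of ?I] by simp
  finally show ?thesis unfolding if_not_P[OF False] .
qed

text \<open>The factor in \<open>A\<close> of a word at \<open>v = a\<close> and
  \<open>x\<^sub>i = g [^] \<chi> i\<close> once the powers of \<open>g\<close> stand on the left;
  \<open>d\<close> translates all marks.\<close>

definition mark_val :: "nat \<Rightarrow> (nat \<Rightarrow> nat) \<Rightarrow> (nat \<Rightarrow> nat) \<Rightarrow> (nat \<Rightarrow> nat) list \<Rightarrow> 'a" where
  "mark_val n d \<chi> cs = foldr (\<lambda>c y. \<tau> (pairing n \<chi> (\<lambda>i. d i + c i)) a \<otimes> y) cs \<one>"

lemma mark_val_mem [simp]: "mark_val n d \<chi> cs \<in> A"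
  by (induction cs) (auto simp: mark_val_def)

lemma mark_val_mem_carrier [simp]: "mark_val n d \<chi> cs \<in> carrier G"
  by (rule A.mem_carrier) simp

lemma mark_val_shift: "\<tau> (pairing n \<chi> d) (mark_val n (\<lambda>_. 0) \<chi> cs) = mark_val n d \<chi> cs"
proof (induction cs)
  case Nil
  have "\<tau> k \<one> = \<one>" for k using g by (simp add: \<tau>_def)
  then show ?case by (simp add: mark_val_def)
next
  case (Cons c cs)
  have "\<tau> (pairing n \<chi> d) (\<tau> (pairing n \<chi> c) a \<otimes> mark_val n (\<lambda>_. 0) \<chi> cs)
      = \<tau> (pairing n \<chi> (\<lambda>i. d i + c i)) a \<otimes> mark_val n d \<chi> cs"
    using Cons by (simp add: \<tau>_mult \<tau>_add pairing_add)
  then show ?case by (simp add: mark_val_def)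
qed

text \<open>One character sum per mark: multiplying over all \<open>\<chi>\<close> erases every mark
  except those that \<open>d\<close> moves to the origin modulo \<open>q\<close>.\<close>

lemma prod_mark_val:
  "prodA (\<lambda>\<chi>. mark_val n d \<chi> cs) (characters n) =
     a [^] (q ^ n * length (filter (\<lambda>c. \<forall>i\<in>{1..n}. q dvd d i + c i) cs))"
proof (induction cs)
  case Nil
  have "prodA (\<lambda>\<chi>. \<one>) (characters n) = \<one>" using A.finprod_one by simp
  then show ?case by (simp add: mark_val_def)
next
  case (Cons c cs)
  have "prodA (\<lambda>\<chi>. mark_val n d \<chi> (c # cs)) (characters n) =
     prodA (\<lambda>\<chi>. \<tau> (pairing n \<chi> (\<lambda>i. d i + c i)) a \<otimes> mark_val n d \<chi> cs) (characters n)"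
    by (simp add: mark_val_def)
  also have "\<dots> = prodA (\<lambda>\<chi>. \<tau> (pairing n \<chi> (\<lambda>i. d i + c i)) a) (characters n) \<otimes>
      prodA (\<lambda>\<chi>. mark_val n d \<chi> cs) (characters n)"
    using A.finprod_multf[of "\<lambda>\<chi>. \<tau> (pairing n \<chi> (\<lambda>i. d i + c i)) a" "characters n" "\<lambda>\<chi>. mark_val n d \<chi> cs"]
    by auto
  also have "\<dots> = a [^] (q ^ n * length (filter (\<lambda>c. \<forall>i\<in>{1..n}. q dvd d i + c i) (c # cs)))"
    unfolding Cons character_sum by (auto simp: nat_pow_mult)
  finally show ?case .
qed

text \<open>Each occurrence of \<open>v\<close> is moved rightwards past the power of
  \<open>g\<close> that its suffix has produced, which turns \<open>a\<close> into
  \<open>\<tau> k a\<close>. The case \<open>c = \<one>\<close> isolates the power of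
  \<open>g\<close>, so that it can be cancelled in the case \<open>c = a\<close>.\<close>

lemma word_val_powers:
  assumes "\<chi> \<in> characters n" "c \<in> {\<one>, a}"
  shows "word_val G (\<lambda>i. if i = 0 then c else if i \<in> {1..n} then g [^] \<chi> i else \<one>) w
    = g [^] pairing n \<chi> (count_list w) \<otimes> (if c = \<one> then \<one> else mark_val n (\<lambda>_. 0) \<chi> (marks w))"
proof (induction w)
  case Nil
  then show ?case by (simp add: pairing_def mark_val_def)
next
  case (Cons l w)
  let ?m = "\<lambda>w. if c = \<one> then \<one> else mark_val n (\<lambda>_. 0) \<chi> (marks w)"
  let ?k = "pairing n \<chi> (count_list w)"
  have m: "?m w \<in> carrier G" by auto
  consider "l = 0" | "l \<in> {1..n}" | "l \<noteq> 0" "l \<notin> {1..n}" by blast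
  then show ?case
  proof cases
    case 1
    have pair: "pairing n \<chi> (count_list (l # w)) = ?k"
      using 1 by (auto simp: pairing_def intro!: sum.cong)
    show ?thesis
    proof (cases "c = \<one>")
      case False
      then have "c = a" using assms by blast
      have "a \<otimes> (g [^] ?k \<otimes> ?m w) = g [^] ?k \<otimes> (\<tau> ?k a \<otimes> ?m w)"
        using g m by (simp add: \<tau>_def conjugate_def m_assoc) (simp add: m_assoc[symmetric])
      then show ?thesis unfolding pair using Cons 1 False \<open>c = a\<close> by (simp add: mark_val_def)
    qed (unfold pair, use Cons 1 g in simp)
  next
    case 2
    have "count_list (l # w) = (\<lambda>i. count_list w i + (if i = l then 1 else 0))" by auto
    moreover have "(\<Sum>i\<in>{1..n}. \<chi> i * (if i = l then 1 else 0)) = \<chi> l"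
      using 2 by (simp add: if_distrib[of "\<lambda>x. _ * x"] sum.delta cong: if_cong)
    ultimately have pair: "pairing n \<chi> (count_list (l # w)) = \<chi> l + ?k"
      by (simp add: pairing_def distrib_left sum.distrib)
    have "l \<noteq> 0" using 2 by auto
    then show ?thesis unfolding pair using Cons 2 g m by (simp add: nat_pow_mult[symmetric] m_assoc)
  next
    case 3
    have pair: "pairing n \<chi> (count_list (l # w)) = ?k"
      using 3 by (auto simp: pairing_def intro!: sum.cong)
    show ?thesis unfolding pair using Cons 3 g m by simp
  qed
qed

text \<open>Evaluate the letter \<open>i\<close> at \<open>g\<close> and all others at
  \<open>\<one>\<close>. The resulting powers of \<open>g\<close> agree, and a trivial power of
  \<open>g\<close> centralizes \<open>b\<close>.\<close>

lemma law_imp_count_cong: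
  assumes "law G w w'"
  shows "[count_list w i = count_list w' i] (mod q)"
proof -
  let ?\<phi> = "\<lambda>j. if j = i then g else \<one>"
  have val: "word_val G ?\<phi> u = g [^] count_list u i" for u
    using g by (induction u) (auto, metis nat_pow_Suc nat_pow_Suc2)
  have "range ?\<phi> \<subseteq> carrier G" using g by auto
  then have "word_val G ?\<phi> w = word_val G ?\<phi> w'" using assms unfolding law_def by blast
  then have "g [^] count_list w i = g [^] count_list w' i" unfolding val .
  then have "g [^] (int (count_list w i) - int (count_list w' i)) = \<one>"
    using g by (simp add: int_pow_diff int_pow_int)
  then have "int q dvd int (count_list w i) - int (count_list w' i)"
    using b by (intro q_dvd_if_centralizes) (auto simp: centralizing_def)
  then show ?thesis by (simp add: cong_int_iff[symmetric] cong_iff_dvd_diff)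
qed

text \<open>Comparing \<open>v = a\<close> with \<open>v = \<one>\<close> removes the power of
  \<open>g\<close>. Translating by \<open>d\<close> and multiplying over all \<open>\<chi>\<close>
  leaves \<open>hits\<close>, scaled by \<open>q ^ n\<close>, as an exponent of \<open>a\<close>;
  the order of \<open>a\<close> is \<open>p\<close>, and \<open>q ^ n\<close> is invertible modulo
  \<open>p\<close>.\<close>

lemma law_imp_hits_cong:
  assumes "law G w w'"
  shows "[hits q n d w = hits q n d w'] (mod p)"
proof -
  have eq: "mark_val n (\<lambda>_. 0) \<chi> (marks w) = mark_val n (\<lambda>_. 0) \<chi> (marks w')" if \<chi>: "\<chi> \<in> characters n" for \<chi>
  proof -
    let ?\<phi> = "\<lambda>c i. if i = 0 then c else if i \<in> {1..n} then g [^] \<chi> i else \<one>"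
    have law: "word_val G (?\<phi> c) w = word_val G (?\<phi> c) w'" if "c \<in> {\<one>, a}" for c
    proof -
      have "range (?\<phi> c) \<subseteq> carrier G" using that g by auto
      then show ?thesis using assms unfolding law_def by blast
    qed
    have "g [^] pairing n \<chi> (count_list w) = g [^] pairing n \<chi> (count_list w')"
      using law[of \<one>] word_val_powers[OF \<chi>, of \<one>] g by simp
    moreover have "g [^] pairing n \<chi> (count_list w) \<otimes> mark_val n (\<lambda>_. 0) \<chi> (marks w) =
      g [^] pairing n \<chi> (count_list w') \<otimes> mark_val n (\<lambda>_. 0) \<chi> (marks w')"
      using law[of a] word_val_powers[OF \<chi>, of a] a_neq_one by simp
    ultimately show ?thesis using g by simp
  qed
  have "mark_val n d \<chi> (marks w) = mark_val n d \<chi> (marks w')" if "\<chi> \<in> characters n" for \<chi>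
    using eq[OF that] mark_val_shift[of n \<chi> d "marks w"] mark_val_shift[of n \<chi> d "marks w'"] by simp
  then have "prodA (\<lambda>\<chi>. mark_val n d \<chi> (marks w)) (characters n) =
      prodA (\<lambda>\<chi>. mark_val n d \<chi> (marks w')) (characters n)"
    by (intro A.finprod_cong') auto
  then have "a [^] (q ^ n * hits q n d w) = a [^] (q ^ n * hits q n d w')"
    unfolding prod_mark_val hits_def .
  then have "a [^] (int (q ^ n * hits q n d w) - int (q ^ n * hits q n d w')) = \<one>"
    by (simp only: int_pow_diff[OF a_carrier] int_pow_int) simp
  then have "int p dvd int (q ^ n * hits q n d w) - int (q ^ n * hits q n d w')"
    using int_pow_eq_id[OF a_carrier] ord_a by simp
  then have "[q ^ n * hits q n d w = q ^ n * hits q n d w'] (mod p)"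
    by (simp add: cong_int_iff[symmetric] cong_iff_dvd_diff)
  moreover have "coprime (q ^ n) p"
    using p q pq by (simp add: primes_coprime)
  ultimately show ?thesis by (simp add: cong_mult_lcancel_nat)
qed

end

section \<open>The twisted algebra\<close>

text \<open>The permutation \<open>u\<close> of \<open>{..p * N}\<close>: each of the
  \<open>N\<close> blocks of \<open>p\<close> consecutive points is rotated, and the last point
  \<open>p * N\<close> is fixed.\<close>

definition block_cycle :: "nat \<Rightarrow> nat \<Rightarrow> nat \<Rightarrow> nat" where
  "block_cycle p N x = (if x < p * N then p * (x div p) + (x mod p + 1) mod p else x)"

text \<open>The permutation \<open>u'\<close>: the same rotation with all blocks moved up by one, so
  that the point \<open>0\<close> is fixed instead.\<close>

definition shifted_block_cycle :: "nat \<Rightarrow> nat \<Rightarrow> nat \<Rightarrow> nat" where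
  "shifted_block_cycle p N x = (case x of 0 \<Rightarrow> 0 | Suc y \<Rightarrow> Suc (block_cycle p N y))"

lemma shifted_block_cycle_simps [simp]:
  "shifted_block_cycle p N 0 = 0"
  "shifted_block_cycle p N (Suc y) = Suc (block_cycle p N y)"
  by (simp_all add: shifted_block_cycle_def)

lemma block_less:
  fixes p :: nat
  assumes "x < p * N" "r < p"
  shows "p * (x div p) + r < p * N"
proof -
  have "x div p < N" using assms by (simp add: less_mult_imp_div_less mult.commute)
  then have "p * Suc (x div p) \<le> p * N" by (intro mult_le_mono2) simp
  then show ?thesis using assms(2) by simp
qed

lemma block_cycle_less: "p > 0 \<Longrightarrow> x < p * N \<Longrightarrow> block_cycle p N x < p * N"
  by (simp add: block_cycle_def block_less)

lemma block_cycle_le: "p > 0 \<Longrightarrow> x \<le> p * N \<Longrightarrow> block_cycle p N x \<le> p * N"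
  using block_cycle_less[of p x N] by (cases "x < p * N") (auto simp: block_cycle_def)

lemma shifted_block_cycle_le: "p > 0 \<Longrightarrow> x \<le> p * N \<Longrightarrow> shifted_block_cycle p N x \<le> p * N"
  using block_cycle_less[of p "x - 1" N] by (cases x) auto

lemma block_cycle_funpow:
  assumes "p > 0" "x < p * N"
  shows "(block_cycle p N ^^ k) x = p * (x div p) + (x mod p + k) mod p"
proof (induction k)
  case (Suc k)
  let ?r = "(x mod p + k) mod p"
  have r: "?r < p" using assms by simp
  have "block_cycle p N (p * (x div p) + ?r) = p * (x div p) + (?r + 1) mod p"
    using r block_less[OF assms(2) r] assms(1) by (simp add: block_cycle_def)
  then show ?case using Suc by (simp add: mod_Suc_eq)
qed simp

lemma block_cycle_order: "p > 0 \<Longrightarrow> (block_cycle p N ^^ p) x = x"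
proof (cases "x < p * N")
  case False
  then have "block_cycle p N x = x" by (simp add: block_cycle_def)
  then have "(block_cycle p N ^^ k) x = x" for k by (induction k) auto
  then show ?thesis .
qed (simp add: block_cycle_funpow)

lemma shifted_block_cycle_order: "p > 0 \<Longrightarrow> (shifted_block_cycle p N ^^ p) x = x"
proof (cases x)
  case 0
  have "(shifted_block_cycle p N ^^ k) 0 = 0" for k
    by (induction k) auto
  then show ?thesis by (simp add: 0)
next
  case (Suc y)
  have "(shifted_block_cycle p N ^^ k) (Suc y) = Suc ((block_cycle p N ^^ k) y)" for k
    by (induction k) auto
  then show "p > 0 \<Longrightarrow> ?thesis" by (simp add: Suc block_cycle_order)
qed

lemma funpow_cong_mod:
  assumes "(f ^^ p) x = x" "[k = m] (mod p)"
  shows "(f ^^ k) x = (f ^^ m) x"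
  using assms funpow_mod_eq[of p f x] by (metis cong_def)

text \<open>The blocks of the two permutations overlap: for \<open>p \<ge> 2\<close> the last point
  of a block of one is not the last point of a block of the other. This is the source of
  transitivity.\<close>

lemma block_cycle_Suc:
  assumes "x < p * N" "p \<ge> 2"
  shows "block_cycle p N x = Suc x \<or> shifted_block_cycle p N x = Suc x"
proof (cases "Suc (x mod p) < p")
  case True
  then have "block_cycle p N x = p * (x div p) + x mod p + 1" using assms by (simp add: block_cycle_def)
  then show ?thesis by simp
next
  case False
  moreover have "x mod p < p" using assms by simp
  ultimately have xm: "x mod p = p - 1" by linarith
  then obtain y where y: "x = Suc y" using assms by (cases x) auto
  have "Suc (y mod p) = p \<or> Suc (y mod p) = x mod p"
    using y by (auto simp: mod_Suc)
  then have ym: "Suc (y mod p) = x mod p" using xm y assms by (auto simp: mod_Suc split: if_splits)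
  then have "y mod p + 1 < p" using xm assms by linarith
  then have "block_cycle p N y = p * (y div p) + y mod p + 1"
    using assms(1) y by (simp add: block_cycle_def)
  then show ?thesis by (simp add: y)
qed

text \<open>The points \<open>(0,\<dots>,0)\<close> and \<open>(1,\<dots>,1)\<close> differ in every coordinate, so without one of the
  translations no orbit sees both.\<close>

definition twist_act :: "nat \<Rightarrow> nat \<Rightarrow> nat \<Rightarrow> nat \<Rightarrow> nat \<Rightarrow> nat \<times> (nat \<Rightarrow> nat) \<Rightarrow> nat \<times> (nat \<Rightarrow> nat)" where
  "twist_act p q N n l = (\<lambda>(x, e).
     if l = 0 then
       (if \<forall>i\<in>{1..n}. q dvd e i then block_cycle p N x
        else if \<forall>i\<in>{1..n}. q dvd e i + (q - 1) then shifted_block_cycle p N x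
        else x, e)
     else (x, e(l := (e l + 1) mod q)))"

lemma twist_act_simps:
  "twist_act p q N n 0 (x, e) =
     (if \<forall>i\<in>{1..n}. q dvd e i then block_cycle p N x
      else if \<forall>i\<in>{1..n}. q dvd e i + (q - 1) then shifted_block_cycle p N x
      else x, e)"
  "l \<noteq> 0 \<Longrightarrow> twist_act p q N n l (x, e) = (x, e(l := (e l + 1) mod q))"
  by (simp_all add: twist_act_def)

definition twist_algebra :: "nat \<Rightarrow> nat \<Rightarrow> nat \<Rightarrow> nat \<Rightarrow> (nat, nat \<times> (nat \<Rightarrow> nat)) alg2" where
  "twist_algebra p q N n =
     \<lparr>sort1 = {0..n}, sort2 = {..p * N} \<times> ({1..n} \<rightarrow>\<^sub>E {..<q}), act = twist_act p q N n\<rparr>"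

lemma algebra2_twist_algebra:
  assumes "p > 0" "q > 0"
  shows "algebra2 (twist_algebra p q N n)"
  using assms
  by (auto simp: algebra2_def twist_algebra_def twist_act_def block_cycle_le shifted_block_cycle_le
      PiE_iff extensional_def)

section \<open>Words acting on the twisted algebra\<close>

definition shift_by :: "nat \<Rightarrow> nat \<Rightarrow> (nat \<Rightarrow> nat) \<Rightarrow> nat list \<Rightarrow> nat \<Rightarrow> nat" where
  "shift_by q n e w = (\<lambda>i\<in>{1..n}. (e i + count_list w i) mod q)"

text \<open>The letter \<open>v\<close> leaves the translate alone, so only the letter counts
  matter.\<close>

lemma snd_foldr_twist_act:
  assumes "e \<in> {1..n} \<rightarrow>\<^sub>E {..<q}" "set w \<subseteq> {0..n}"
  shows "snd (foldr (twist_act p q N n) w (x, e)) = shift_by q n e w"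
  using assms(2)
proof (induction w)
  case Nil
  show ?case
    using assms(1) by (auto simp: shift_by_def PiE_iff extensional_def fun_eq_iff)
next
  case (Cons l w)
  then have "snd (foldr (twist_act p q N n) w (x, e)) = shift_by q n e w" by simp
  then show ?case
    using Cons.prems
    by (cases "foldr (twist_act p q N n) w (x, e)")
      (cases "l = 0"; auto simp: twist_act_simps shift_by_def fun_eq_iff mod_Suc_eq)
qed

lemma fst_foldr_twist_act_no_0:
  "0 \<notin> set w \<Longrightarrow> fst (foldr (twist_act p q N n) w (x, e)) = x"
proof (induction w)
  case (Cons l w)
  then show ?case
    by (cases "foldr (twist_act p q N n) w (x, e)") (auto simp: twist_act_simps)
qed simp

lemma hits_Cons:
  "hits q n d (l # w) = (if l = 0 \<and> (\<forall>i\<in>{1..n}. q dvd d i + count_list w i) then Suc (hits q n d w)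
     else hits q n d w)"
  by (simp add: hits_def)

text \<open>Without the letter \<open>j\<close> the \<open>j\<close>-th coordinate never changes, so
  \<open>e j\<close> decides in advance which special fibre can be visited. Adding
  \<open>q - 1\<close> subtracts 1 modulo \<open>q\<close> within the natural numbers; it moves
  \<open>(1,...,1)\<close> to the origin, where \<open>hits\<close> counts.\<close>

lemma fst_foldr_twist_act:
  assumes e: "e \<in> {1..n} \<rightarrow>\<^sub>E {..<q}" and w: "set w \<subseteq> {0..n}" and j: "j \<in> {1..n}" "j \<notin> set w"
    and q: "q \<ge> 2"
  shows "fst (foldr (twist_act p q N n) w (x, e)) =
    (if q dvd e j then (block_cycle p N ^^ hits q n e w) x
     else if q dvd e j + (q - 1) then (shifted_block_cycle p N ^^ hits q n (\<lambda>i. e i + (q - 1)) w) x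
     else x)"
  using w j(2)
proof (induction w)
  case Nil
  then show ?case by (simp add: hits_def)
next
  case (Cons l w)
  let ?s = "foldr (twist_act p q N n) w (x, e)"
  have w: "set w \<subseteq> {0..n}" "j \<notin> set w" using Cons.prems by auto
  have s: "?s = (fst ?s, shift_by q n e w)"
    using snd_foldr_twist_act[OF e w(1)] by (metis prod.collapse)
  note IH = Cons.IH[OF w]
  have cj: "count_list w j = 0" using w(2) by simp
  \<comment> \<open>For \<open>q \<ge> 2\<close> the coordinate \<open>e j\<close> cannot be both 0
    and 1 modulo \<open>q\<close>.\<close>
  have "\<not> q dvd q - 1" using q by (auto dest: dvd_imp_le)
  then have excl: "\<not> q dvd e j + (q - 1)" if "q dvd e j" using that by (simp add: dvd_add_right_iff)
  have d0: "q dvd shift_by q n e w i \<longleftrightarrow> q dvd e i + count_list w i" if "i \<in> {1..n}" for i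
    using that by (simp add: shift_by_def dvd_mod_iff)
  have d1: "q dvd shift_by q n e w i + (q - 1) \<longleftrightarrow> q dvd e i + (q - 1) + count_list w i" if "i \<in> {1..n}" for i
  proof -
    have "q dvd shift_by q n e w i + (q - 1) \<longleftrightarrow> q dvd (e i + count_list w i) mod q + (q - 1)"
      using that by (simp add: shift_by_def)
    also have "\<dots> \<longleftrightarrow> q dvd (e i + count_list w i) + (q - 1)"
      by (simp only: dvd_eq_mod_eq_0 mod_add_left_eq)
    finally show ?thesis by (simp add: add.commute add.left_commute)
  qed
  show ?case
  proof (cases "l = 0")
    case False
    then show ?thesis
      using IH by (cases ?s) (simp add: twist_act_simps hits_Cons)
  next
    case True
    define P0 where "P0 \<longleftrightarrow> (\<forall>i\<in>{1..n}. q dvd e i + count_list w i)"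
    define P1 where "P1 \<longleftrightarrow> (\<forall>i\<in>{1..n}. q dvd e i + (q - 1) + count_list w i)"
    have step: "fst (foldr (twist_act p q N n) (l # w) (x, e)) =
      (if P0 then block_cycle p N (fst ?s) else if P1 then shifted_block_cycle p N (fst ?s) else fst ?s)"
      using True d0 d1
      by (subst foldr.simps, unfold comp_def, subst s) (simp add: twist_act_simps P0_def P1_def)
    \<comment> \<open>The letter \<open>j\<close> does not occur, so a visit to a special fibre
      means that the \<open>j\<close>-th coordinate was right from the start.\<close>
    have "q dvd e j" if P0 using that j(1) cj by (force simp: P0_def)
    moreover have "q dvd e j + (q - 1)" if P1 using that j(1) cj by (force simp: P1_def)
    moreover have "hits q n e (l # w) = (if P0 then Suc (hits q n e w) else hits q n e w)"
      "hits q n (\<lambda>i. e i + (q - 1)) (l # w) =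
        (if P1 then Suc (hits q n (\<lambda>i. e i + (q - 1)) w) else hits q n (\<lambda>i. e i + (q - 1)) w)"
      using True by (simp_all add: hits_Cons P0_def P1_def)
    ultimately show ?thesis
      unfolding step IH using excl
      by (cases "q dvd e j"; cases "q dvd e j + (q - 1)"; cases P0; cases P1) auto
  qed
qed

text \<open>The counts modulo \<open>q\<close> determine the translate. The first component is
  untouched if \<open>v\<close> is the missing letter; otherwise it is moved by a power of a
  permutation whose \<open>p\<close>-th power is trivial, and the exponent is a value of
  \<open>hits\<close>.\<close>

lemma twist_act_cong:
  assumes pq: "p > 0" "q \<ge> 2" and e: "e \<in> {1..n} \<rightarrow>\<^sub>E {..<q}"
    and w: "set w \<subseteq> {0..n} - {j}" "set w' \<subseteq> {0..n} - {j}" "j \<in> {0..n}"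
    and count: "\<And>i. [count_list w i = count_list w' i] (mod q)"
    and hits: "\<And>d. [hits q n d w = hits q n d w'] (mod p)"
  shows "foldr (twist_act p q N n) w (x, e) = foldr (twist_act p q N n) w' (x, e)"
proof (rule prod_eqI)
  have w': "set w \<subseteq> {0..n}" "set w' \<subseteq> {0..n}" "j \<notin> set w" "j \<notin> set w'" using w by auto
  have "[e i + count_list w i = e i + count_list w' i] (mod q)" for i
    using count by (intro cong_add cong_refl)
  then have "shift_by q n e w = shift_by q n e w'" by (simp add: shift_by_def cong_def)
  then show "snd (foldr (twist_act p q N n) w (x, e)) = snd (foldr (twist_act p q N n) w' (x, e))"
    using snd_foldr_twist_act[OF e w'(1)] snd_foldr_twist_act[OF e w'(2)] by simp
  show "fst (foldr (twist_act p q N n) w (x, e)) = fst (foldr (twist_act p q N n) w' (x, e))"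
  proof (cases "j = 0")
    case True
    then show ?thesis using w' fst_foldr_twist_act_no_0 by simp
  next
    case False
    then have j: "j \<in> {1..n}" using w(3) by auto
    show ?thesis
      unfolding fst_foldr_twist_act[OF e w'(1) j w'(3) pq(2)] fst_foldr_twist_act[OF e w'(2) j w'(4) pq(2)]
      using funpow_cong_mod[OF block_cycle_order[OF pq(1)] hits]
        funpow_cong_mod[OF shifted_block_cycle_order[OF pq(1)] hits] by simp
  qed
qed

text \<open>The translations connect all points with the same first component. Over the two special
  fibres \<open>v\<close> acts by the two block permutations, one of which raises the first
  component by one.\<close>

lemma twist_algebra_reachable:
  assumes pq: "p \<ge> 2" "q \<ge> 2" and n: "n \<ge> 1"
    and closed: "\<And>l z. l \<in> {0..n} \<Longrightarrow> z \<in> X \<Longrightarrow> twist_act p q N n l z \<in> X"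
    and base: "(0, \<lambda>i\<in>{1..n}. 0) \<in> X"
  shows "sort2 (twist_algebra p q N n) \<subseteq> X"
proof -
  have coord: "(x, e(i := s)) \<in> X"
    if "(x, e) \<in> X" "e i < q" "i \<in> {1..n}" "s < q" for x e i s
  proof -
    have "(x, e(i := (e i + k) mod q)) \<in> X" for k
    proof (induction k)
      case (Suc k)
      have "twist_act p q N n i (x, e(i := (e i + k) mod q)) \<in> X"
        using that(3) by (intro closed[OF _ Suc]) auto
      also have "twist_act p q N n i (x, e(i := (e i + k) mod q)) = (x, e(i := (e i + Suc k) mod q))"
        using that(3) by (auto simp: twist_act_simps fun_eq_iff mod_Suc_eq)
      finally show ?case .
    qed (use that in \<open>simp add: fun_upd_idem\<close>)
    \<comment> \<open>This many unit translations lead from \<open>e i\<close> to \<open>s\<close>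
      modulo \<open>q\<close>.\<close>
    from this[of "s + (q - e i)"] show ?thesis using that by simp
  qed
  have move: "(x, e') \<in> X"
    if e: "(x, e) \<in> X" "e \<in> {1..n} \<rightarrow>\<^sub>E {..<q}" "e' \<in> {1..n} \<rightarrow>\<^sub>E {..<q}" for x e e'
  proof -
    have "(x, \<lambda>i. if i \<in> F then e' i else e i) \<in> X" if "finite F" "F \<subseteq> {1..n}" for F
      using that
    proof (induction F)
      case (insert k F)
      then have "(x, (\<lambda>i. if i \<in> F then e' i else e i)(k := e' k)) \<in> X"
        using e(2,3) by (intro coord) (auto simp: PiE_iff)
      also have "(\<lambda>i. if i \<in> F then e' i else e i)(k := e' k) = (\<lambda>i. if i \<in> insert k F then e' i else e i)"
        by auto
      finally show ?case .
    qed (use e in simp)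
    from this[of "{1..n}"] have "(x, \<lambda>i. if i \<in> {1..n} then e' i else e i) \<in> X" by simp
    also have "(\<lambda>i. if i \<in> {1..n} then e' i else e i) = e'"
      using e(2,3) by (intro ext) (auto simp: PiE_iff extensional_def)
    finally show ?thesis .
  qed
  define e0 where "e0 = (\<lambda>i\<in>{1..n}. 0 :: nat)"
  define e1 where "e1 = (\<lambda>i\<in>{1..n}. 1 :: nat)"
  have e01: "e0 \<in> {1..n} \<rightarrow>\<^sub>E {..<q}" "e1 \<in> {1..n} \<rightarrow>\<^sub>E {..<q}" using pq by (auto simp: e0_def e1_def)
  have climb: "(x, e0) \<in> X" if "x \<le> p * N" for x
    using that
  proof (induction x)
    case (Suc x)
    have x0: "(x, e0) \<in> X" by (rule Suc.IH) (use Suc.prems in simp)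
    have "twist_act p q N n 0 (x, e0) = (block_cycle p N x, e0)"
      by (simp add: twist_act_simps e0_def)
    then have b: "(block_cycle p N x, e0) \<in> X" using closed[OF _ x0, of 0] by simp
    have x1: "(x, e1) \<in> X" using move[OF x0 e01] .
    \<comment> \<open>The definition of the action tests the origin first; \<open>n \<ge> 1\<close>
      and \<open>q \<ge> 2\<close> keep \<open>(1,...,1)\<close> apart from it.\<close>
    have "\<not> (\<forall>i\<in>{1..n}. q dvd e1 i)" using n pq by (intro notI) (auto simp: e1_def dest!: bspec[of _ _ 1])
    then have "twist_act p q N n 0 (x, e1) = (shifted_block_cycle p N x, e1)"
      using pq by (simp add: twist_act_simps e1_def)
    then have "(shifted_block_cycle p N x, e1) \<in> X" using closed[OF _ x1, of 0] by simp
    then have "(shifted_block_cycle p N x, e0) \<in> X" using move e01 by blast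
    then show ?case using b block_cycle_Suc[of x p N] Suc.prems pq by auto
  qed (use base in \<open>simp add: e0_def\<close>)
  show ?thesis using climb move e01(1) by (auto simp: twist_algebra_def)
qed

section \<open>Words in subalgebras and copies\<close>

lemma foldr_act_subalgebra2:
  assumes "subalgebra2 C B" "set w \<subseteq> sort1 C" "y \<in> sort2 C"
  shows "foldr (act C) w y = foldr (act B) w y \<and> foldr (act C) w y \<in> sort2 C"
  using assms(2)
proof (induction w)
  case (Cons l w)
  then show ?case using assms(1) by (auto simp: subalgebra2_def algebra2_def)
qed (use assms in simp)

lemma foldr_act_copy2:
  assumes "algebra2 A" "inj_on f (sort1 A)" "inj_on h (sort2 A)" "set w \<subseteq> sort1 A" "z \<in> sort2 A"
  shows "foldr (act (copy2 f h A)) (map f w) (h z) = h (foldr (act A) w z) \<and> foldr (act A) w z \<in> sort2 A"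
  using assms(4)
proof (induction w)
  case (Cons l w)
  then show ?case using assms(1-3) by (auto simp: act_copy2 algebra2_def)
qed (use assms in simp)

text \<open>The operation produces no first-sort elements, so shrinking the first carrier to the
  generators \<open>U1\<close> leaves a subalgebra; hence \<open>U1\<close> is the whole first
  sort.\<close>

lemma generated2_card_sort1:
  assumes "algebra2 C" "generated2 n m C"
  shows "card (sort1 C) \<le> n"
proof -
  obtain U1 U2 where U: "card U1 \<le> n" "generates2 C U1 U2"
    using assms(2) by (auto simp: generated2_def)
  have "subalgebra2 (C\<lparr>sort1 := U1\<rparr>) C"
    using assms(1) U(2) by (auto simp: subalgebra2_def algebra2_def generates2_def)
  then have "U1 = sort1 C"
    using U(2) unfolding generates2_def by (metis alg2.select_convs alg2.surjective alg2.update_convs(1) order_refl)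
  then show ?thesis using U(1) by simp
qed

section \<open>The algebra \<open>B\<close> and its small subalgebras\<close>

theorem theorem3p4:
  fixes G :: "('g, 'm) monoid_scheme"
    and S :: "'s set"
    and \<alpha> :: "'g \<Rightarrow> 's \<Rightarrow> 's"
    and n l :: nat
  assumes "group G"
    and "finite (carrier G)"
    and "\<not> nilpotent_group G"
    and "faithful_action G S \<alpha>"
    and "n \<ge> 2"
    and "l > 0"
  shows "\<exists>B :: (nat, nat) alg2.
           algebra2 B \<and> everywhere_nonempty B \<and>
           generated2 (n + 1) 1 B \<and>
           finite (sort1 B) \<and> finite (sort2 B) \<and>
           card (sort2 B) \<ge> l \<and>
           (\<forall>C. subalgebra2 C B \<and> everywhere_nonempty C \<and> generated2 n n C \<longrightarrow>
                in_variety TYPE('i :: infinite) {action_algebra G S \<alpha>} C)"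
proof -
  obtain K :: "'g monoid" and p q A b g where
    laws: "\<And>w w'. law G w w' \<Longrightarrow> law K w w'" and cc: "coprime_conjugation K p q A b g"
  proof (rule non_nilpotent_structure[OF assms(1-3)])
    fix K :: "'g monoid" and p q :: nat and A b g
    assume "group K" "\<And>w w'. law G w w' \<Longrightarrow> law K w w'"
      "prime p" "prime q" "p \<noteq> q" "A \<lhd> K"
      "\<And>x y. x \<in> A \<Longrightarrow> y \<in> A \<Longrightarrow> x \<otimes>\<^bsub>K\<^esub> y = y \<otimes>\<^bsub>K\<^esub> x" "\<And>x. x \<in> A \<Longrightarrow> x [^]\<^bsub>K\<^esub> p = \<one>\<^bsub>K\<^esub>"
      "g \<in> carrier K" "\<And>x. x \<in> A \<Longrightarrow> (g [^]\<^bsub>K\<^esub> q) \<otimes>\<^bsub>K\<^esub> x = x \<otimes>\<^bsub>K\<^esub> (g [^]\<^bsub>K\<^esub> q)"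
      "b \<in> A" "g \<otimes>\<^bsub>K\<^esub> b \<noteq> b \<otimes>\<^bsub>K\<^esub> g"
    then show thesis
      by (intro that[of K p q A b g]) (auto simp: coprime_conjugation_def coprime_conjugation_axioms_def)
  qed
  interpret cc: coprime_conjugation K p q A b g by (rule cc)
  have p2: "p \<ge> 2" and q2: "q \<ge> 2" using cc.p cc.q by (auto simp: prime_ge_2_nat)
  have nontriv: "carrier G \<noteq> {\<one>\<^bsub>G\<^esub>}"
    using assms(1,3) unfolding nilpotent_group_def by (metis lower_central.simps(1))
  \<comment> \<open>With \<open>l\<close> blocks the first component ranges over
    \<open>p * l + 1\<close> points, enough for the bound on the cardinality.\<close>
  let ?T = "twist_algebra p q l n"
  let ?e0 = "\<lambda>i\<in>{1..n}. 0 :: nat"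
  have T: "algebra2 ?T" using p2 q2 by (intro algebra2_twist_algebra) auto
  have finT: "finite (sort2 ?T)" by (auto simp: twist_algebra_def intro!: finite_PiE)
  \<comment> \<open>The carriers must consist of natural numbers, so the finite second sort is
    numbered by \<open>h\<close>.\<close>
  obtain h :: "nat \<times> (nat \<Rightarrow> nat) \<Rightarrow> nat" where h: "inj_on h (sort2 ?T)"
    using finite_imp_inj_to_nat_seg[OF finT] by blast
  define B where "B = copy2 id h ?T"
  have B1: "sort1 B = {0..n}" and B2: "sort2 B = h ` sort2 ?T"
    by (simp_all add: B_def) (simp add: twist_algebra_def)
  have algB: "algebra2 B" unfolding B_def using T h by (intro algebra2_copy2) auto
  have base: "(0, ?e0) \<in> sort2 ?T" using q2 by (auto simp: twist_algebra_def)
  have ne: "everywhere_nonempty B" using B1 B2 base by (auto simp: everywhere_nonempty_def)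
  have actB: "act B k (h z) = h (twist_act p q l n k z)" if "k \<in> {0..n}" "z \<in> sort2 ?T" for k z
    using act_copy2[of id ?T h k z] that h by (simp add: B_def twist_algebra_def)
  have actT: "twist_act p q l n k z \<in> sort2 ?T" if "k \<in> {0..n}" "z \<in> sort2 ?T" for k z
    using T that by (auto simp: algebra2_def twist_algebra_def)
  have "generates2 B {0..n} {h (0, ?e0)}"
    unfolding generates2_def
  proof (intro conjI allI impI)
    fix C assume C: "subalgebra2 C B \<and> {0..n} \<subseteq> sort1 C \<and> {h (0, ?e0)} \<subseteq> sort2 C"
    then show "sort1 C = sort1 B" using B1 by (auto simp: subalgebra2_def)
    \<comment> \<open>The points whose codes lie in \<open>C\<close>: they include the base point
      and are closed under all letters, so reachability applies.\<close>
    let ?X = "{z \<in> sort2 ?T. h z \<in> sort2 C}"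
    have "sort2 ?T \<subseteq> ?X"
    proof (rule twist_algebra_reachable)
      fix k z assume kz: "k \<in> {0..n}" "z \<in> ?X"
      then have "act C k (h z) \<in> sort2 C" "act C k (h z) = act B k (h z)"
        using C by (auto simp: subalgebra2_def algebra2_def)
      then show "twist_act p q l n k z \<in> ?X" using kz actB actT by simp
    qed (use p2 q2 assms(5) base C in auto)
    then show "sort2 C = sort2 B" using C B2 by (auto simp: subalgebra2_def)
  qed (use B1 B2 base in auto)
  then have gen: "generated2 (n + 1) 1 B"
    unfolding generated2_def by (intro exI[of _ "{0..n}"] exI[of _ "{h (0, ?e0)}"]) simp
  have "l \<le> card (sort2 B)"
  proof -
    have "inj_on (\<lambda>x. (x, ?e0)) {..p * l}" by (auto intro: inj_onI)
    moreover have "(\<lambda>x. (x, ?e0)) ` {..p * l} \<subseteq> sort2 ?T" using q2 by (auto simp: twist_algebra_def)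
    ultimately have "card {..p * l} \<le> card (sort2 ?T)" using finT by (metis card_inj_on_le)
    moreover have "1 * l \<le> p * l" using p2 by (intro mult_le_mono1) simp
    ultimately have "l \<le> card (sort2 ?T)" by (simp only: card_atMost)
    then show ?thesis using h by (simp add: B2 card_image)
  qed
  moreover have "in_variety TYPE('i) {action_algebra G S \<alpha>} C"
    if C: "subalgebra2 C B" "everywhere_nonempty C" "generated2 n n C" for C
  proof (rule in_variety_if_laws[OF assms(4,2) nontriv])
    show algC: "algebra2 C" using C by (simp add: subalgebra2_def)
    have C1: "sort1 C \<subseteq> {0..n}" and C2: "sort2 C \<subseteq> h ` sort2 ?T"
      using C(1) B1 B2 by (auto simp: subalgebra2_def)
    then show "finite (sort1 C)" "finite (sort2 C)" using finT finite_subset by blast+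
    \<comment> \<open>At most \<open>n\<close> of the \<open>n + 1\<close> letters are available in
      \<open>C\<close>, so some letter \<open>j\<close> is missing.\<close>
    have "sort1 C \<noteq> {0..n}" using generated2_card_sort1[OF algC C(3)] by auto
    then obtain j where j: "j \<in> {0..n}" "sort1 C \<subseteq> {0..n} - {j}" using C1 by blast
    fix w w' y assume w: "set w \<subseteq> sort1 C" "set w' \<subseteq> sort1 C" and law: "law G w w'" and y: "y \<in> sort2 C"
    obtain x e where z: "(x, e) \<in> sort2 ?T" "y = h (x, e)" using y C2 by auto
    have fold: "foldr (act C) u y = h (foldr (twist_act p q l n) u (x, e))" if "set u \<subseteq> sort1 C" for u
    proof -
      have "set u \<subseteq> sort1 ?T" using that C1 by (auto simp: twist_algebra_def)
      then have "foldr (act B) u y = h (foldr (act ?T) u (x, e))"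
        using foldr_act_copy2[OF T, of id h u "(x, e)"] h z by (simp add: B_def)
      then show ?thesis using foldr_act_subalgebra2[OF C(1) that y] by (simp add: twist_algebra_def)
    qed
    have "foldr (twist_act p q l n) w (x, e) = foldr (twist_act p q l n) w' (x, e)"
      using p2 q2 z(1) w j cc.law_imp_count_cong[OF laws[OF law]] cc.law_imp_hits_cong[OF laws[OF law]]
      by (intro twist_act_cong[of p q e n w j w']) (auto simp: twist_algebra_def)
    then show "foldr (act C) w y = foldr (act C) w' y" using fold w by simp
  qed (rule C(2))
  ultimately show ?thesis
    using algB ne gen finT B1 B2 by (intro exI[of _ B]) auto
qed

end
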